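(* Let $(M,\tau)$ be a von Neumann algebra with a normal faithful trace-state and let $Y_j\in M_h$, $Z_j\in M_h$, $1\le j\le n$, be such that $\{Y_1,\dots,Y_n\}$ and $\{Z_1,\dots,Z_n\}$ are independent or freely independent. Let $W_{Y+Z}$ and $W_Z$ be the von Neumann subalgebras of $M$ generated by $\{I,Y_1+Z_1,\dots,Y_n+Z_n\}$ and $\{I,Z_1,\dots,Z_n\}$ respectively, and let $E$ be the ($\tau$-preserving) conditional expectation of $M$ onto $W_{Y+Z}$. If $\xi=(\xi_j)_{1\le j\le n}\in (W_Z)_h^n$ is such that $\tau\big(\sum_{1\le j\le n}\xi_j\,(\delta_jP)(Z)\big)=0$ for all $P\in\mathbb{C}_{\langle n\rangle}$, then $$\tau\Big(\sum_{1\le j\le n}\xi_j\,(\delta_jP)(Y+Z)\Big)=0\quad\text{for all }P\in\mathbb{C}_{\langle n\rangle}.$$ In particular $(E\xi_j)_{1\le j\le n}$ is in the orthogonal to $\delta\mathbb{C}_{\langle n\rangle}(Y+Z)$ in $(W_{Y+Z,h})^n$.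
   Context: For a von Neumann algebra $M$, $M_h$ denotes its hermitian elements (and $W_{Y+Z,h}$ those of $W_{Y+Z}$). Two sets are independent in $(M,\tau)$ if the unital subalgebras $M_1,M_2$ they generate commute and $\tau(m_1m_2)=\tau(m_1)\tau(m_2)$ for $m_i\in M_i$; freely independent is the usual freeness of the generated unital subalgebras. $Y+Z=(Y_j+Z_j)_{1\le j\le n}$. $\mathbb{C}_{\langle n\rangle}=\mathbb{C}\langle X_1,\dots,X_n\rangle$ is the ring of noncommutative polynomials; the partial cyclic derivatives are the linear maps $\delta_j:\mathbb{C}_{\langle n\rangle}\to\mathbb{C}_{\langle n\rangle}$ with $\delta_j1=0$, $\delta_jX_{i_1}\cdots X_{i_p}=\sum_{k:\,i_k=j}X_{i_{k+1}}\cdots X_{i_p}X_{i_1}\cdots X_{i_{k-1}}$; $\delta\mathbb{C}_{\langle n\rangle}(Y+Z)=\{((\delta_jP)(Y+Z))_j:P\in\mathbb{C}_{\langle n\rangle}\}$. An $n$-tuple $(a_j)$ of hermitian elements is in the orthogonal to this set if $\sum_j\tau(a_j(\delta_jP)(Y+Z))=0$ for all $P\in\mathbb{C}_{\langle n\rangle}$. *)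

theory Defs
  imports "HOL-Analysis.Analysis" "HOL-Library.Poly_Mapping"
begin

section \<open>Complex Hilbert spaces\<close>

class complex_vector = real_vector +
  fixes scaleC :: "complex \<Rightarrow> 'a \<Rightarrow> 'a"  (infixr "*\<^sub>C" 75)
  assumes scaleC_add_right: "c *\<^sub>C (x + y) = c *\<^sub>C x + c *\<^sub>C y"
    and scaleC_add_left: "(c + d) *\<^sub>C x = c *\<^sub>C x + d *\<^sub>C x"
    and scaleC_scaleC: "c *\<^sub>C d *\<^sub>C x = (c * d) *\<^sub>C x"
    and scaleC_of_real: "complex_of_real r *\<^sub>C x = r *\<^sub>R x"

text \<open>The complex inner product is linear in the first argument.  Its real part is the inner
  product of \<^class>\<open>real_inner\<close>, so that norm, topology and completeness are those of the
  library.\<close>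

class complex_hilbert = complex_vector + real_inner + complete_space +
  fixes cinner :: "'a \<Rightarrow> 'a \<Rightarrow> complex"
  assumes cinner_commute: "cinner x y = cnj (cinner y x)"
    and cinner_add_left: "cinner (x + y) z = cinner x z + cinner y z"
    and cinner_scaleC_left: "cinner (c *\<^sub>C x) y = c * cinner x y"
    and Re_cinner: "Re (cinner x y) = inner x y"


section \<open>The algebra of bounded operators\<close>

typedef (overloaded) 'h bop =
  "{T :: 'h::complex_hilbert \<Rightarrow> 'h. bounded_linear T \<and> (\<forall>c x. T (c *\<^sub>C x) = c *\<^sub>C T x)}"
  morphisms app Bop
  by (rule exI[of _ "\<lambda>x. x"]) (simp add: bounded_linear_ident)

setup_lifting type_definition_bop

lemma bounded_linear_scaleC:
  "bounded_linear (\<lambda>x::'h::complex_hilbert. c *\<^sub>C x)"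
proof (rule bounded_linear_intro[where K = "cmod c"])
  fix x y :: 'h and r :: real
  show "c *\<^sub>C (x + y) = c *\<^sub>C x + c *\<^sub>C y" by (rule scaleC_add_right)
  show "c *\<^sub>C (r *\<^sub>R x) = r *\<^sub>R (c *\<^sub>C x)"
    by (simp add: scaleC_of_real[symmetric] scaleC_scaleC mult.commute)
  have "cinner (c *\<^sub>C x) (c *\<^sub>C x) = c * cnj c * cinner x x"
    by (metis cinner_commute cinner_scaleC_left complex_cnj_mult mult.assoc)
  also have "c * cnj c = of_real ((cmod c)\<^sup>2)"
    by (metis complex_norm_square of_real_power)
  finally have "(norm (c *\<^sub>C x))\<^sup>2 = (norm x * cmod c)\<^sup>2"
    by (metis Re_cinner Re_complex_of_real dot_square_norm mult.commute power_mult_distrib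
        scaleR_complex.sel(1) scaleR_conv_of_real)
  then show "norm (c *\<^sub>C x) \<le> norm x * cmod c"
    by (simp add: power2_eq_iff_nonneg)
qed

lemma scaleC_zero_right: "c *\<^sub>C (0::'a::complex_vector) = 0"
  using scaleC_add_right[of c 0 "0::'a"] by simp

lemma scaleC_minus_right: "c *\<^sub>C (- x) = - (c *\<^sub>C (x::'a::complex_vector))"
  using scaleC_add_right[of c "- x" x] by (simp add: scaleC_zero_right eq_neg_iff_add_eq_0)

instantiation bop :: (complex_hilbert) complex_vector
begin

lift_definition zero_bop :: "'a bop" is "\<lambda>_. 0"
  by (simp add: scaleC_zero_right)

lift_definition plus_bop :: "'a bop \<Rightarrow> 'a bop \<Rightarrow> 'a bop" is "\<lambda>S T x. S x + T x"
  by (simp add: bounded_linear_add scaleC_add_right)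

lift_definition uminus_bop :: "'a bop \<Rightarrow> 'a bop" is "\<lambda>T x. - T x"
  by (simp add: scaleC_minus_right bounded_linear_minus)

definition minus_bop :: "'a bop \<Rightarrow> 'a bop \<Rightarrow> 'a bop"
  where "S - T = S + - (T :: 'a bop)"

lift_definition scaleC_bop :: "complex \<Rightarrow> 'a bop \<Rightarrow> 'a bop" is "\<lambda>c T x. c *\<^sub>C T x"
  by (auto simp: scaleC_scaleC mult.commute
      intro!: bounded_linear_compose[OF bounded_linear_scaleC])

definition scaleR_bop :: "real \<Rightarrow> 'a bop \<Rightarrow> 'a bop"
  where "r *\<^sub>R T = complex_of_real r *\<^sub>C (T :: 'a bop)"

instance
proof
  fix S T U :: "'a bop" and r s :: real and c d :: complex
  show "S + T + U = S + (T + U)" "S + T = T + S" "0 + T = T" "- T + T = 0"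
    by (transfer, simp add: algebra_simps)+
  show "S - T = S + - T" by (rule minus_bop_def)
  show "r *\<^sub>R (S + T) = r *\<^sub>R S + r *\<^sub>R T" "(r + s) *\<^sub>R T = r *\<^sub>R T + s *\<^sub>R T"
    "r *\<^sub>R s *\<^sub>R T = (r * s) *\<^sub>R T" "1 *\<^sub>R T = T"
    unfolding scaleR_bop_def
    by (transfer, simp only: scaleC_of_real scaleR_add_right scaleR_add_left scaleR_scaleR
        scaleR_one)+
  show "c *\<^sub>C (S + T) = c *\<^sub>C S + c *\<^sub>C T" "(c + d) *\<^sub>C T = c *\<^sub>C T + d *\<^sub>C T"
    "c *\<^sub>C d *\<^sub>C T = (c * d) *\<^sub>C T"
    by (transfer, simp add: scaleC_add_right scaleC_add_left scaleC_scaleC)+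
  show "complex_of_real r *\<^sub>C T = r *\<^sub>R T" by (simp add: scaleR_bop_def)
qed

end

text \<open>Not an instance of \<^class>\<open>ring_1\<close>, because the Hilbert space may be zero-dimensional.\<close>

instantiation bop :: (complex_hilbert) "{ring, monoid_mult}"
begin

lift_definition one_bop :: "'a bop" is "\<lambda>x. x"
  by (simp add: bounded_linear_ident)

lift_definition times_bop :: "'a bop \<Rightarrow> 'a bop \<Rightarrow> 'a bop" is "\<lambda>S T x. S (T x)"
  by (auto intro: bounded_linear_compose)

instance
proof
  fix S T U :: "'a bop"
  show "S * T * U = S * (T * U)" "1 * T = T" "T * 1 = T" "(S + T) * U = S * U + T * U"
    by (transfer, simp)+
  show "S * (T + U) = S * T + S * U"
    by transfer (auto simp: linear_simps)
qed

end

definition adj :: "'h::complex_hilbert bop \<Rightarrow> 'h bop" where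
  "adj T = (THE S. \<forall>x y. cinner (app T x) y = cinner x (app S y))"

definition hermitian_part :: "'h::complex_hilbert bop set \<Rightarrow> 'h bop set" where
  "hermitian_part A = {T \<in> A. adj T = T}"

definition positive_op :: "'h::complex_hilbert bop \<Rightarrow> bool" where
  "positive_op T \<longleftrightarrow> (\<forall>x. cinner (app T x) x \<in> \<real>\<^sub>\<ge>\<^sub>0)"

definition op_le :: "'h::complex_hilbert bop \<Rightarrow> 'h bop \<Rightarrow> bool"  (infix "\<preceq>" 50) where
  "S \<preceq> T \<longleftrightarrow> positive_op (T - S)"


section \<open>Von Neumann algebras\<close>

definition commutant :: "'h::complex_hilbert bop set \<Rightarrow> 'h bop set" where
  "commutant A = {T. \<forall>S\<in>A. S * T = T * S}"

definition von_neumann_algebra :: "'h::complex_hilbert bop set \<Rightarrow> bool" where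
  "von_neumann_algebra A \<longleftrightarrow> (\<forall>T\<in>A. adj T \<in> A) \<and> commutant (commutant A) = A"

text \<open>The identity operator belongs to every von Neumann algebra in the above sense, hence to
  the generated ones.\<close>

definition vn_generated :: "'h::complex_hilbert bop set \<Rightarrow> 'h bop set" where
  "vn_generated S = von_neumann_algebra hull S"

definition unital_subalgebra :: "'h::complex_hilbert bop set \<Rightarrow> bool" where
  "unital_subalgebra A \<longleftrightarrow> 1 \<in> A \<and> (\<forall>S\<in>A. \<forall>T\<in>A. S + T \<in> A \<and> S * T \<in> A)
     \<and> (\<forall>c. \<forall>T\<in>A. c *\<^sub>C T \<in> A)"

definition alg_generated :: "'h::complex_hilbert bop set \<Rightarrow> 'h bop set" where
  "alg_generated S = unital_subalgebra hull S"

text \<open>A functional on \<open>M\<close> is a function on all operators of which only the values on \<open>M\<close>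
  matter.\<close>

definition trace_state ::
  "'h::complex_hilbert bop set \<Rightarrow> ('h bop \<Rightarrow> complex) \<Rightarrow> bool" where
  "trace_state M \<tau> \<longleftrightarrow>
     (\<forall>S\<in>M. \<forall>T\<in>M. \<tau> (S + T) = \<tau> S + \<tau> T) \<and>
     (\<forall>c. \<forall>T\<in>M. \<tau> (c *\<^sub>C T) = c * \<tau> T) \<and>
     (\<forall>T\<in>M. positive_op T \<longrightarrow> \<tau> T \<in> \<real>\<^sub>\<ge>\<^sub>0) \<and>
     \<tau> 1 = 1 \<and>
     (\<forall>S\<in>M. \<forall>T\<in>M. \<tau> (S * T) = \<tau> (T * S))"

definition faithful_on ::
  "'h::complex_hilbert bop set \<Rightarrow> ('h bop \<Rightarrow> complex) \<Rightarrow> bool" where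
  "faithful_on M \<tau> \<longleftrightarrow> (\<forall>T\<in>M. positive_op T \<and> \<tau> T = 0 \<longrightarrow> T = 0)"

definition is_lub_in ::
  "'h::complex_hilbert bop set \<Rightarrow> 'h bop set \<Rightarrow> 'h bop \<Rightarrow> bool" where
  "is_lub_in A D T \<longleftrightarrow> T \<in> A \<and> (\<forall>S\<in>D. S \<preceq> T) \<and> (\<forall>U\<in>A. (\<forall>S\<in>D. S \<preceq> U) \<longrightarrow> T \<preceq> U)"

text \<open>Normality of a positive functional: it preserves suprema of bounded upward directed sets of
  hermitian elements.\<close>

definition normal_on ::
  "'h::complex_hilbert bop set \<Rightarrow> ('h bop \<Rightarrow> complex) \<Rightarrow> bool" where
  "normal_on M \<tau> \<longleftrightarrow>
     (\<forall>D T. D \<noteq> {} \<and> D \<subseteq> hermitian_part M \<and>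
        (\<forall>S\<in>D. \<forall>S'\<in>D. \<exists>U\<in>D. S \<preceq> U \<and> S' \<preceq> U) \<and>
        is_lub_in (hermitian_part M) D T
        \<longrightarrow> Re (\<tau> T) = (SUP S\<in>D. Re (\<tau> S)))"

definition conditional_expectation ::
  "'h::complex_hilbert bop set \<Rightarrow> 'h bop set \<Rightarrow> ('h bop \<Rightarrow> 'h bop) \<Rightarrow> bool" where
  "conditional_expectation M N E \<longleftrightarrow>
     (\<forall>S\<in>M. \<forall>T\<in>M. E (S + T) = E S + E T) \<and>
     (\<forall>c. \<forall>T\<in>M. E (c *\<^sub>C T) = c *\<^sub>C E T) \<and>
     (\<forall>T\<in>M. E T \<in> N) \<and>
     (\<forall>T\<in>N. E T = T) \<and>
     (\<forall>T\<in>M. positive_op T \<longrightarrow> positive_op (E T)) \<and>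
     (\<forall>S\<in>N. \<forall>T\<in>M. \<forall>U\<in>N. E (S * T * U) = S * E T * U)"

definition trace_preserving ::
  "'h::complex_hilbert bop set \<Rightarrow> ('h bop \<Rightarrow> complex) \<Rightarrow> ('h bop \<Rightarrow> 'h bop) \<Rightarrow> bool" where
  "trace_preserving M \<tau> E \<longleftrightarrow> (\<forall>T\<in>M. \<tau> (E T) = \<tau> T)"


section \<open>Independence and freeness\<close>

definition independent_in ::
  "('h::complex_hilbert bop \<Rightarrow> complex) \<Rightarrow> 'h bop set \<Rightarrow> 'h bop set \<Rightarrow> bool" where
  "independent_in \<tau> A B \<longleftrightarrow>
     (\<forall>S\<in>alg_generated A. \<forall>T\<in>alg_generated B. S * T = T * S \<and> \<tau> (S * T) = \<tau> S * \<tau> T)"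

text \<open>An alternating product is given by a list of operators, each paired with the index of the
  subalgebra it is taken from.\<close>

definition free_family ::
  "('h::complex_hilbert bop \<Rightarrow> complex) \<Rightarrow> ('i \<Rightarrow> 'h bop set) \<Rightarrow> bool" where
  "free_family \<tau> A \<longleftrightarrow>
     (\<forall>xs. xs \<noteq> [] \<and> distinct_adj (map fst xs) \<and> (\<forall>(i, T)\<in>set xs. T \<in> A i \<and> \<tau> T = 0)
        \<longrightarrow> \<tau> (prod_list (map snd xs)) = 0)"

definition freely_independent_in ::
  "('h::complex_hilbert bop \<Rightarrow> complex) \<Rightarrow> 'h bop set \<Rightarrow> 'h bop set \<Rightarrow> bool" where
  "freely_independent_in \<tau> A B \<longleftrightarrow>
     free_family \<tau> (\<lambda>b::bool. if b then alg_generated A else alg_generated B)"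


section \<open>Noncommutative polynomials and partial cyclic derivatives\<close>

text \<open>A noncommutative polynomial is the finitely supported family of the coefficients of its
  monomials; the monomial \<open>X\<^bsub>i\<^sub>1\<^esub> \<dots> X\<^bsub>i\<^sub>p\<^esub>\<close> is the word \<open>[i\<^sub>1, \<dots>, i\<^sub>p]\<close>.  The number of
  indeterminates is the cardinality of \<open>'n\<close>.\<close>

type_synonym 'n ncpoly = "'n list \<Rightarrow>\<^sub>0 complex"

definition nc_eval ::
  "'n ncpoly \<Rightarrow> ('n \<Rightarrow> 'h::complex_hilbert bop) \<Rightarrow> 'h bop" where
  "nc_eval P X = (\<Sum>w\<in>Poly_Mapping.keys P. Poly_Mapping.lookup P w *\<^sub>C prod_list (map X w))"

definition cyc_deriv :: "'n \<Rightarrow> 'n ncpoly \<Rightarrow> 'n ncpoly" where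
  "cyc_deriv j P =
     (\<Sum>w\<in>Poly_Mapping.keys P. \<Sum>k | k < length w \<and> w ! k = j.
        Poly_Mapping.single (drop (Suc k) w @ take k w) (Poly_Mapping.lookup P w))"

lemma cyc_deriv_single:
  "cyc_deriv j (Poly_Mapping.single w c) =
     (\<Sum>k | k < length w \<and> w ! k = j. Poly_Mapping.single (drop (Suc k) w @ take k w) c)"
  by (cases "c = 0") (auto simp: cyc_deriv_def)

lemma cyc_deriv_add: "cyc_deriv j (P + Q) = cyc_deriv j P + cyc_deriv j Q"
proof -
  let ?f = "\<lambda>w c. \<Sum>k | k < length w \<and> w ! k = j.
    Poly_Mapping.single (drop (Suc k) w @ take k w) (c::complex)"
  have sup: "cyc_deriv j R = (\<Sum>w\<in>A. ?f w (Poly_Mapping.lookup R w))"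
    if "finite A" "Poly_Mapping.keys R \<subseteq> A" for R A
    unfolding cyc_deriv_def using that
    by (intro sum.mono_neutral_left) (auto simp: in_keys_iff)
  have "finite (Poly_Mapping.keys P \<union> Poly_Mapping.keys Q)" by simp
  from this show ?thesis
    using Poly_Mapping.keys_add[of P Q]
    by (simp add: sup[of "Poly_Mapping.keys P \<union> Poly_Mapping.keys Q"] lookup_add
        Poly_Mapping.single_add sum.distrib)
qed

definition cyc_grad_orthogonal ::
  "('h::complex_hilbert bop \<Rightarrow> complex) \<Rightarrow> ('n::finite \<Rightarrow> 'h bop) \<Rightarrow> ('n \<Rightarrow> 'h bop) set" where
  "cyc_grad_orthogonal \<tau> X =
     {a. (\<forall>j. a j \<in> hermitian_part (vn_generated (range X))) \<and>
         (\<forall>P. (\<Sum>j\<in>UNIV. \<tau> (a j * nc_eval (cyc_deriv j P) X)) = 0)}"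

end

theory Submission
  imports Defs
begin

text \<open>Call a pair \<open>(a, a')\<close> a letter with its derivative.  By the trace property \<open>\<Sum>\<^sub>j \<tau>(\<xi>\<^sub>j (\<delta>\<^sub>j P)(X))\<close>
  is the trace of the Leibniz derivative of \<open>P(X)\<close> with \<open>X\<^sub>j' = \<xi>\<^sub>j\<close>.  Splitting
  \<open>(Y\<^sub>j + Z\<^sub>j, \<xi>\<^sub>j) = (Y\<^sub>j, 0) + (Z\<^sub>j, \<xi>\<^sub>j)\<close> leaves mixed words.  In the independent case the factors
  from \<open>Y\<close> split off.  In the free case merging, cyclic rotation and centering reduce to cyclically
  alternating centered words, where freeness applies.  In both cases the derivatives lie in \<open>W\<^sub>Z\<close>
  and not in the algebra \<open>A\<close> generated by \<open>Z\<close>, so one needs that \<open>\<tau>(A d) = 0\<close> implies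
  \<open>\<tau>(W\<^sub>Z d) = 0\<close>.  This follows because the \<open>L\<^sup>2\<close>-projection onto the closure of \<open>A\<close> commutes with
  the left multiplication by elements of \<open>A''\<close>; that is checked on operators \<open>Q\<close> with
  \<open>\<parallel>T Q\<parallel>\<^sub>2 \<le> \<parallel>T x\<parallel>\<close> for some vector \<open>x\<close>, which are plentiful by normality of \<open>\<tau>\<close>.\<close>

section \<open>Hilbert space preliminaries\<close>

text \<open>Independence and freeness are given for algebras of polynomials only, while each
  \<open>\<xi> j\<close> is merely a limit of such polynomials. Strong approximation of S in the
  bicommutant by T in A works at finitely many vectors and gives no bound on the norm of T, so by
  itself it does not control \<open>tnorm (S - T)\<close>. For Q dominated by a vector x, closeness
  of S and T at x makes \<open>tnorm ((S - T) * Q)\<close> small, which is enough to see the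
  commutator of S with the L2 projection vanish at Q. This commutator is bounded for
  \<open>tnorm\<close>, hence its vanishing passes to sums and \<open>tnorm\<close> limits of
  dominated operators, and so to 1. On the algebraic side, the hypothesis on \<xi> says that a' has
  trace 0 for every pair (a, a') spanned by words in the letters (Z j, \<xi> j). These pairs are
  stable under products and under subtracting scalars from a, since scalars have derivative 0, so
  merging and centering stay within the class of words considered.\<close>

lemma subspace_closure:
  fixes W :: "'a::real_normed_vector set"
  assumes W: "subspace W"
  shows "subspace (closure W)"
  unfolding subspace_def
proof (intro conjI ballI allI)
  show "0 \<in> closure W" using subspace_0[OF W] closure_subset by blast
  fix u assume "u \<in> closure W"
  then obtain f where f: "\<And>n. f n \<in> W" "f \<longlonglongrightarrow> u" unfolding closure_sequential by blast
  show "r *\<^sub>R u \<in> closure W" for r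
    unfolding closure_sequential using f subspace_scale[OF W]
    by (intro exI[of _ "\<lambda>n. r *\<^sub>R f n"]) (auto intro: tendsto_intros)
  fix v assume "v \<in> closure W"
  then obtain g where g: "\<And>n. g n \<in> W" "g \<longlonglongrightarrow> v" unfolding closure_sequential by blast
  show "u + v \<in> closure W"
    unfolding closure_sequential using f g subspace_add[OF W]
    by (intro exI[of _ "\<lambda>n. f n + g n"]) (auto intro: tendsto_intros)
qed

lemma orthogonal_projection_exists:
  fixes V :: "'a::{real_inner,complete_space} set"
  assumes sub: "subspace V" and cl: "closed V"
  shows "\<exists>v\<in>V. \<forall>w\<in>V. inner (x - v) w = 0"
proof -
  define d where "d = (INF v\<in>V. (norm (x - v))\<^sup>2)"
  have ne: "V \<noteq> {}" using sub subspace_0 by blast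
  have bdd: "bdd_below ((\<lambda>v. (norm (x - v))\<^sup>2) ` V)" by (rule bdd_belowI2[of _ 0]) simp
  have low: "d \<le> (norm (x - v))\<^sup>2" if "v \<in> V" for v
    unfolding d_def by (rule cINF_lower[OF bdd that])
  have "\<exists>v\<in>V. (norm (x - v))\<^sup>2 < d + 1 / real (Suc n)" for n
  proof -
    have "d < d + 1 / real (Suc n)" by simp
    then show ?thesis unfolding d_def using cINF_less_iff[OF ne bdd] by blast
  qed
  then obtain v where vV: "\<And>n. v n \<in> V" and vd: "\<And>n. (norm (x - v n))\<^sup>2 < d + 1 / real (Suc n)"
    by metis
  \<comment> \<open>Parallelogram identity: the midpoint of two near-minimizers lies in V, so its
    squared distance to x is at least \<open>d\<close>, which forces the two to be close.\<close>
  have par: "(norm (v m - v n))\<^sup>2 \<le> 2 / real (Suc m) + 2 / real (Suc n)" for m n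
  proof -
    have mid: "(1/2) *\<^sub>R (v m + v n) \<in> V" by (intro subspace_scale subspace_add sub vV)
    have "(norm (v m - v n))\<^sup>2 = 2 * (norm (x - v m))\<^sup>2 + 2 * (norm (x - v n))\<^sup>2
        - 4 * (norm (x - (1/2) *\<^sub>R (v m + v n)))\<^sup>2"
      by (simp add: power2_norm_eq_inner inner_diff_left inner_diff_right inner_add_left
          inner_add_right inner_commute algebra_simps)
    moreover have "2 / real (Suc k) = 2 * (1 / real (Suc k))" for k by simp
    ultimately show ?thesis using low[OF mid] vd[of m] vd[of n] by linarith
  qed
  have "Cauchy v"
  proof (rule metric_CauchyI)
    fix e :: real assume e: "0 < e"
    obtain N where N: "4 / e\<^sup>2 < real (Suc N)" 
      using reals_Archimedean2[of "4 / e\<^sup>2"] by (meson lessI of_nat_less_iff order_less_trans)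
    show "\<exists>M. \<forall>m\<ge>M. \<forall>n\<ge>M. dist (v m) (v n) < e"
    proof (intro exI allI impI)
      fix m n assume mn: "N \<le> m" "N \<le> n"
      have "2 / real (Suc m) \<le> 2 / real (Suc N)" "2 / real (Suc n) \<le> 2 / real (Suc N)"
        using mn by (auto intro!: divide_left_mono)
      then have "(norm (v m - v n))\<^sup>2 \<le> 4 / real (Suc N)" using par[of m n] by simp
      also have "\<dots> < e\<^sup>2" using N e by (simp add: field_simps)
      finally show "dist (v m) (v n) < e" using e
        by (simp add: dist_norm power_less_imp_less_base)
    qed
  qed
  then obtain l where l: "v \<longlonglongrightarrow> l" using Cauchy_convergent convergent_def by blast
  have lV: "l \<in> V" using closed_sequentially[OF cl] vV l by blast
  have "(\<lambda>n. (norm (x - v n))\<^sup>2) \<longlonglongrightarrow> (norm (x - l))\<^sup>2" by (intro tendsto_intros l)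
  moreover have "(\<lambda>n. d + 1 / real (Suc n)) \<longlonglongrightarrow> d + 0"
    by (intro tendsto_add tendsto_const LIMSEQ_Suc[OF lim_1_over_n])
  ultimately have "(norm (x - l))\<^sup>2 \<le> d + 0"
    by (rule LIMSEQ_le) (intro exI allI impI less_imp_le vd)
  then have ld: "(norm (x - l))\<^sup>2 \<le> d" by simp
  have "inner (x - l) w = 0" if w: "w \<in> V" for w
  proof (cases "w = 0")
    case False
    \<comment> \<open>The best correction of l in the direction w; minimality of l leaves no room
      for a nonzero t.\<close>
    define t where "t = inner (x - l) w / inner w w"
    have "l + t *\<^sub>R w \<in> V" by (intro subspace_add subspace_scale sub lV w)
    from low[OF this] ld have "(norm (x - l))\<^sup>2 \<le> (norm (x - (l + t *\<^sub>R w)))\<^sup>2"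
      by linarith
    then have "2 * t * inner (x - l) w \<le> t\<^sup>2 * inner w w"
      unfolding power2_norm_eq_inner
      by (simp add: inner_diff_left inner_diff_right inner_add_left inner_add_right inner_commute
          algebra_simps power2_eq_square)
    moreover have "inner w w > 0" using False by simp
    ultimately have "2 * t * (t * inner w w) \<le> t\<^sup>2 * inner w w"
      unfolding t_def by simp
    then have "t\<^sup>2 * inner w w \<le> 0" by (simp add: power2_eq_square algebra_simps)
    moreover have "t\<^sup>2 * inner w w > 0" if "t \<noteq> 0" using that \<open>inner w w > 0\<close> by simp
    ultimately have "t = 0" by force
    with \<open>inner w w > 0\<close> show ?thesis unfolding t_def by simp
  qed simp
  with lV show ?thesis by blast
qed

lemma riesz_representation:
  fixes f :: "'a::{real_inner,complete_space} \<Rightarrow> real"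
  assumes f: "bounded_linear f"
  shows "\<exists>z. \<forall>x. f x = inner x z"
proof (cases "\<forall>x. f x = 0")
  case True
  then show ?thesis by (intro exI[of _ 0]) simp
next
  case False
  interpret bounded_linear f by (rule f)
  obtain x0 where x0: "f x0 \<noteq> 0" using False by blast
  let ?V = "{x. f x = 0}"
  have "subspace ?V" by (auto simp: subspace_def zero add scale)
  moreover have "closed ?V"
    by (intro closed_Collect_eq continuous_intros) (simp add: isCont continuous_at_imp_continuous_on)
  ultimately obtain v where v: "f v = 0" "\<And>w. f w = 0 \<Longrightarrow> inner (x0 - v) w = 0"
    using orthogonal_projection_exists[of ?V x0] by auto
  define r where "r = x0 - v"
  have fr: "f r \<noteq> 0" using x0 v by (simp add: r_def diff)
  then have r: "inner r r \<noteq> 0" using zero by auto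
  have "f x = inner x ((f r / inner r r) *\<^sub>R r)" for x
  proof -
    have "f (x - (f x / f r) *\<^sub>R r) = 0" using fr by (simp add: diff scale)
    from v(2)[OF this] have "inner x r = f x / f r * inner r r"
      by (simp add: r_def[symmetric] inner_diff_right inner_commute)
    then show ?thesis using r fr by simp
  qed
  then show ?thesis by blast
qed

section \<open>Complex inner products, operator calculus and adjoints\<close>

lemma cinner_add_right: "cinner x (y + z) = cinner x y + cinner x (z::'h::complex_hilbert)"
  by (metis cinner_add_left cinner_commute complex_cnj_add)

lemma cinner_scaleC_right: "cinner x (c *\<^sub>C y) = cnj c * cinner x (y::'h::complex_hilbert)"
  by (metis cinner_scaleC_left cinner_commute complex_cnj_mult)

lemma scaleC_minus_one: "(- 1) *\<^sub>C x = - (x::'a::complex_vector)"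
  using scaleC_of_real[of "- 1" x] by simp

lemma scaleC_one [simp]: "1 *\<^sub>C x = (x::'a::complex_vector)"
  using scaleC_of_real[of 1 x] by simp

lemma scaleC_zero_left [simp]: "0 *\<^sub>C x = (0::'a::complex_vector)"
  using scaleC_of_real[of 0 x] by simp

lemma scaleC_minus_left: "(- c) *\<^sub>C x = - (c *\<^sub>C (x::'a::complex_vector))"
  using scaleC_scaleC[of "-1" c x] by (simp add: scaleC_minus_one)

lemma cinner_minus_left: "cinner (- x) (y::'h::complex_hilbert) = - cinner x y"
  using cinner_scaleC_left[of "- 1" x y] by (simp add: scaleC_minus_one)

lemma cinner_minus_right: "cinner x (- y::'h::complex_hilbert) = - cinner x y"
  using cinner_scaleC_right[of x "- 1" y] by (simp add: scaleC_minus_one)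

lemma cinner_diff_left: "cinner (x - y) (z::'h::complex_hilbert) = cinner x z - cinner y z"
  using cinner_add_left[of x "- y" z] by (simp add: cinner_minus_left)

lemma cinner_diff_right: "cinner x (y - z::'h::complex_hilbert) = cinner x y - cinner x z"
  using cinner_add_right[of x y "- z"] by (simp add: cinner_minus_right)

lemma cinner_zero [simp]: "cinner 0 y = 0" "cinner x 0 = (0::complex)"
  for x y :: "'h::complex_hilbert"
  using cinner_diff_left[of 0 0 y] cinner_diff_right[of x 0 0] by simp_all

lemma cinner_conv_inner:
  "cinner x y = Complex (inner x y) (- inner (\<i> *\<^sub>C x) (y::'h::complex_hilbert))"
  by (simp add: complex_eq_iff Re_cinner[symmetric] cinner_scaleC_left)

lemma inner_scaleC_left: "inner (c *\<^sub>C x) y = inner x (cnj c *\<^sub>C (y::'h::complex_hilbert))"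
  by (simp add: Re_cinner[symmetric] cinner_scaleC_left cinner_scaleC_right)

lemma cinner_eqI: "(\<And>z::'h::complex_hilbert. cinner z x = cinner z y) \<Longrightarrow> x = y"
proof -
  assume "\<And>z. cinner z x = cinner z y"
  then have "cinner (x - y) (x - y) = 0" by (simp add: cinner_diff_right)
  then have "inner (x - y) (x - y) = 0" by (simp add: Re_cinner[symmetric])
  then show "x = y" by simp
qed

lemma bounded_linear_app: "bounded_linear (app T)"
  using app[of T] by simp

lemma app_scaleC: "app T (c *\<^sub>C x) = c *\<^sub>C app T x"
  using app[of T] by simp

lemmas app_add = linear_add[OF bounded_linear.linear[OF bounded_linear_app]]
  and app_diff = linear_diff[OF bounded_linear.linear[OF bounded_linear_app]]
  and app_zero [simp] = linear_0[OF bounded_linear.linear[OF bounded_linear_app]]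
  and app_scaleR = linear_scale[OF bounded_linear.linear[OF bounded_linear_app]]
  and tendsto_app = bounded_linear.tendsto[OF bounded_linear_app]

lemma bop_eqI: "(\<And>x. app S x = app T x) \<Longrightarrow> S = T"
  by (simp add: app_inject[symmetric] fun_eq_iff)

lemma app_bop_simps [simp]:
  "app 0 x = 0" "app 1 x = x" "app (S + T) x = app S x + app T x" "app (- S) x = - app S x"
  "app (S - T) x = app S x - app T x" "app (c *\<^sub>C S) x = c *\<^sub>C app S x"
  "app (S * T) x = app S (app T x)"
proof -
  show "app (S - T) x = app S x - app T x"
    unfolding minus_bop_def plus_bop.rep_eq uminus_bop.rep_eq by simp
qed (simp_all add: zero_bop.rep_eq one_bop.rep_eq plus_bop.rep_eq uminus_bop.rep_eq
      scaleC_bop.rep_eq times_bop.rep_eq)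

lemma app_scaleR_bop [simp]: "app (r *\<^sub>R S) x = r *\<^sub>R app S x"
  unfolding scaleR_bop_def app_bop_simps by (rule scaleC_of_real)

lemma scaleC_mult_left: "(c *\<^sub>C S) * T = c *\<^sub>C (S * (T::'h::complex_hilbert bop))"
  by (rule bop_eqI) simp

lemma scaleC_mult_right: "S * (c *\<^sub>C T) = c *\<^sub>C (S * (T::'h::complex_hilbert bop))"
  by (rule bop_eqI) (simp add: app_scaleC)

lemma app_bound: "\<exists>K>0. \<forall>x. norm (app T x) \<le> K * norm x"
  using bounded_linear.pos_bounded[OF bounded_linear_app, of T] by (simp add: mult.commute)

text \<open>The real Riesz theorem suffices: since T commutes with multiplication by \<i>, the
  imaginary part of the inner product is recovered from the real one, and the representing vector
  then depends complex linearly on y.\<close>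

lemma adj_exists: "\<exists>S. \<forall>x y. cinner (app T x) y = cinner x (app S (y::'h::complex_hilbert))"
proof -
  have "\<exists>z. \<forall>x. inner (app T x) y = inner x z" for y
    by (intro riesz_representation bounded_linear_inner_left_comp bounded_linear_app)
  then obtain g where g: "\<And>x y. inner (app T x) y = inner x (g y)" by metis
  have cg: "cinner (app T x) y = cinner x (g y)" for x y
    unfolding cinner_conv_inner app_scaleC[symmetric] g ..
  have add: "g (x + y) = g x + g y" for x y
    by (rule cinner_eqI) (simp add: cg[symmetric] cinner_add_right)
  have sc: "g (c *\<^sub>C x) = c *\<^sub>C g x" for c x
    by (rule cinner_eqI) (simp add: cg[symmetric] cinner_scaleC_right)
  obtain K where K: "K > 0" "\<And>x. norm (app T x) \<le> K * norm x" using app_bound by blast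
  have bd: "norm (g y) \<le> norm y * K" for y
  proof -
    have "(norm (g y))\<^sup>2 = inner (app T (g y)) y" by (simp add: g power2_norm_eq_inner)
    also have "\<dots> \<le> norm (app T (g y)) * norm y" by (rule norm_cauchy_schwarz)
    also have "\<dots> \<le> K * norm (g y) * norm y" by (intro mult_right_mono K) simp
    finally show ?thesis by (cases "g y = 0") (auto simp: power2_eq_square K(1) less_imp_le mult_ac)
  qed
  have "bounded_linear g"
  proof (rule bounded_linear_intro[OF add _ bd])
    fix r :: real and x
    show "g (r *\<^sub>R x) = r *\<^sub>R g x" using sc[of "complex_of_real r" x] by (simp add: scaleC_of_real)
  qed
  then have "app (Bop g) = g" by (intro Bop_inverse) (simp add: sc)
  then show ?thesis using cg by (intro exI[of _ "Bop g"]) simp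
qed

lemma cinner_adj: "cinner (app T x) y = cinner x (app (adj T) y)"
proof -
  have "\<exists>!S. \<forall>x y. cinner (app T x) y = cinner x (app S y)"
  proof (rule ex_ex1I[OF adj_exists])
    fix S S' assume "\<forall>x y. cinner (app T x) y = cinner x (app S y)"
      "\<forall>x y. cinner (app T x) y = cinner x (app S' y)"
    then show "S = S'" by (intro bop_eqI cinner_eqI) metis
  qed
  from theI'[OF this] show ?thesis unfolding adj_def by blast
qed

lemma adj_eqI: "(\<And>x y. cinner (app T x) y = cinner x (app S y)) \<Longrightarrow> adj T = S"
  by (intro bop_eqI cinner_eqI) (simp add: cinner_adj[symmetric])

lemma cinner_adj': "cinner (app (adj T) x) y = cinner x (app T y)"
  by (metis cinner_adj cinner_commute)

lemma inner_adj: "inner (app T x) y = inner x (app (adj T) y)"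
  by (simp add: Re_cinner[symmetric] cinner_adj)

lemma inner_adj': "inner (app (adj T) x) y = inner x (app T y)"
  by (simp add: Re_cinner[symmetric] cinner_adj')

lemma adj_adj [simp]: "adj (adj T) = T"
  by (rule adj_eqI) (simp add: cinner_adj')

lemma adj_simps [simp]:
  "adj 0 = 0" "adj 1 = 1" "adj (S + T) = adj S + adj T" "adj (- S) = - adj S"
  "adj (S - T) = adj S - adj T" "adj (c *\<^sub>C S) = cnj c *\<^sub>C adj S" "adj (S * T) = adj T * adj S"
  by (rule adj_eqI; simp add: cinner_add_left cinner_add_right cinner_minus_left cinner_minus_right
      cinner_diff_left cinner_diff_right cinner_scaleC_left cinner_scaleC_right cinner_adj)+

lemma adj_scaleR [simp]: "adj (r *\<^sub>R S) = r *\<^sub>R adj S"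
  unfolding scaleR_bop_def by simp

section \<open>Density of a selfadjoint algebra in its bicommutant\<close>

lemma unital_subalgebraD:
  assumes "unital_subalgebra A"
  shows "1 \<in> A" "S \<in> A \<Longrightarrow> T \<in> A \<Longrightarrow> S + T \<in> A" "S \<in> A \<Longrightarrow> T \<in> A \<Longrightarrow> S * T \<in> A"
    "T \<in> A \<Longrightarrow> c *\<^sub>C T \<in> A" "0 \<in> A" "T \<in> A \<Longrightarrow> - T \<in> A" "S \<in> A \<Longrightarrow> T \<in> A \<Longrightarrow> S - T \<in> A"
    "T \<in> A \<Longrightarrow> r *\<^sub>R T \<in> A"
proof -
  show r: "1 \<in> A" "S \<in> A \<Longrightarrow> T \<in> A \<Longrightarrow> S + T \<in> A" "S \<in> A \<Longrightarrow> T \<in> A \<Longrightarrow> S * T \<in> A"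
    "T \<in> A \<Longrightarrow> c *\<^sub>C T \<in> A" for S T c
    using assms by (auto simp: unital_subalgebra_def)
  show "T \<in> A \<Longrightarrow> r *\<^sub>R T \<in> A" unfolding scaleR_bop_def by (rule r(4))
  show "0 \<in> A" using r(4)[OF r(1), of 0] by simp
  show m: "T \<in> A \<Longrightarrow> - T \<in> A" for T using r(4)[of T "-1"] by (simp add: scaleC_minus_one)
  show "S \<in> A \<Longrightarrow> T \<in> A \<Longrightarrow> S - T \<in> A" using r(2)[OF _ m] unfolding minus_bop_def by blast
qed

lemma Bop_app:
  assumes "bounded_linear f" "\<And>c x. f (c *\<^sub>C x) = c *\<^sub>C f x"
  shows "app (Bop f) = f"
  using assms by (simp add: Bop_inverse)

text \<open>Von Neumann's density argument on two copies of the space, on which T acts diagonally.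
  The projection P onto the closure V has matrix entries in the commutant of A, with which S
  commutes, and P fixes (x, y) because 1 is in A. P comes from the real inner product of pairs, so
  complex linearity of its entries needs an argument of its own.\<close>

lemma bicommutant_pair:
  assumes A: "unital_subalgebra A" and adjA: "\<And>T. T \<in> A \<Longrightarrow> adj T \<in> A"
    and S: "S \<in> commutant (commutant A)"
  shows "(app S x, app S y) \<in> closure ((\<lambda>T. (app T x, app T y)) ` A)"
proof -
  let ?W = "(\<lambda>T. (app T x, app T y)) ` A"
  define V where "V = closure ?W"
  define L where "L T u = (app T (fst u), app T (snd u))" for T and u :: "'a \<times> 'a"
  have contL: "continuous_on UNIV (L T)" for T
    unfolding L_def
    by (intro continuous_intros linear_continuous_on_compose[OF _ bounded_linear.linear] 
        bounded_linear.continuous_on[OF bounded_linear_app])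
  have L_V: "L T v \<in> V" if T: "\<And>S. S \<in> A \<Longrightarrow> T * S \<in> A" and v: "v \<in> V" for T v
  proof -
    have "L T ` closure ?W \<subseteq> closure ?W"
    proof (rule image_closure_subset)
      show "continuous_on (closure ?W) (L T)" using contL continuous_on_subset by blast
      show "L T ` ?W \<subseteq> closure ?W"
      proof
        fix u assume "u \<in> L T ` ?W"
        then obtain R where R: "R \<in> A" "u = (app (T * R) x, app (T * R) y)"
          by (auto simp: L_def)
        then show "u \<in> closure ?W" using T[OF R(1)]
            by (intro subsetD[OF closure_subset[of ?W]] image_eqI[of _ _ "T * R"]) simp_all
      qed
    qed simp
    with v show ?thesis by (auto simp: V_def)
  qed
  have L_A: "L T v \<in> V" if "T \<in> A" "v \<in> V" for T v
    using L_V that unital_subalgebraD(3)[OF A] by blast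
  \<comment> \<open>Invariance of V under complex scalars is what makes the entries of P complex
    linear.\<close>
  have L_1: "L (c *\<^sub>C 1) v \<in> V" if "v \<in> V" for c v
    using L_V that unital_subalgebraD(1,4)[OF A] L_A by blast
  have "subspace ?W"
  proof (unfold subspace_def, intro conjI ballI allI)
    show "0 \<in> ?W" using unital_subalgebraD(5)[OF A]
      by (intro image_eqI[of _ _ 0]) (simp_all add: zero_prod_def)
    show "u + v \<in> ?W" if uv: "u \<in> ?W" "v \<in> ?W" for u v
    proof -
      obtain F G where "F \<in> A" "G \<in> A" "u = (app F x, app F y)" "v = (app G x, app G y)"
        using uv by auto
      then show ?thesis using unital_subalgebraD(2)[OF A]
        by (intro image_eqI[of _ _ "F + G"]) auto
    qed
    show "r *\<^sub>R u \<in> ?W" if u: "u \<in> ?W" for r u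
    proof -
      obtain F where "F \<in> A" "u = (app F x, app F y)" using u by auto
      then show ?thesis using unital_subalgebraD(8)[OF A]
        by (intro image_eqI[of _ _ "r *\<^sub>R F"]) auto
    qed
  qed
  then have sub: "subspace V" unfolding V_def by (rule subspace_closure)
  have clV: "closed V" by (simp add: V_def)
  obtain P where PV: "\<And>u. P u \<in> V" and Po: "\<And>u w. w \<in> V \<Longrightarrow> inner (u - P u) w = 0"
    using orthogonal_projection_exists[OF sub clV] by metis
  have P_eqI: "P u = v" if "v \<in> V" "\<And>w. w \<in> V \<Longrightarrow> inner (u - v) w = 0" for u v
  proof -
    have "P u - v \<in> V" by (intro subspace_diff sub PV that)
    then have "inner (u - v) (P u - v) = 0" "inner (u - P u) (P u - v) = 0" using that Po by auto
    then have "inner (P u - v) (P u - v) = 0" by (simp add: inner_diff_left)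
    then show ?thesis by simp
  qed
  \<comment> \<open>Invariance of V under the adjoint of T makes the orthogonal complement invariant
    under T; together with invariance of V itself, P commutes with T.\<close>
  have P_L: "P (L T u) = L T (P u)"
    if "\<And>v. v \<in> V \<Longrightarrow> L T v \<in> V" "\<And>v. v \<in> V \<Longrightarrow> L (adj T) v \<in> V" for T u
  proof (rule P_eqI)
    show "L T (P u) \<in> V" using that PV by blast
    fix w assume "w \<in> V"
    then have "inner (u - P u) (L (adj T) w) = 0" using that Po by blast
    then show "inner (L T u - L T (P u)) w = 0"
      by (cases u; cases "P u"; cases w) (simp add: L_def inner_diff_left inner_adj)
  qed
  have P_add: "P (u + v) = P u + P v" for u v
  proof (rule P_eqI)
    fix w assume "w \<in> V"
    then show "inner (u + v - (P u + P v)) w = 0" using Po[of w u] Po[of w v]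
      by (simp add: inner_diff_left inner_add_left)
  qed (intro subspace_add sub PV)
  have P_scale: "P (c *\<^sub>C a, c *\<^sub>C b) = (c *\<^sub>C fst (P (a, b)), c *\<^sub>C snd (P (a, b)))" for c a b
    using P_L[of "c *\<^sub>C 1" "(a, b)"] L_1 by (simp add: L_def)
  have P_lin: "bounded_linear P"
  proof (rule bounded_linear_intro[where K = 1])
    show "P (u + v) = P u + P v" for u v by (rule P_add)
    show "P (r *\<^sub>R u) = r *\<^sub>R P u" for r u
    proof (cases u)
      case (Pair a b)
      then show ?thesis
        using P_scale[of "complex_of_real r" a b] by (simp add: scaleC_of_real scaleR_prod_def)
    qed
    show "norm (P u) \<le> norm u * 1" for u
    proof -
      have "inner (P u) (P u) = inner u (P u)" using Po[OF PV, of u u] by (simp add: inner_diff_left)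
      then have "(norm (P u))\<^sup>2 \<le> norm u * norm (P u)"
        by (metis norm_cauchy_schwarz power2_norm_eq_inner)
      then show ?thesis by (cases "P u = 0") (auto simp: power2_eq_square)
    qed
  qed
  \<comment> \<open>\<open>e\<close> embeds a summand and \<open>f\<close> reads one off: the four
    choices are the entries of the 2 by 2 matrix of P.\<close>
  have comm: "app S (f (P (e z))) = f (P (e (app S z)))"
    if f: "f = fst \<or> f = snd" and e: "e = (\<lambda>x. (x, 0)) \<or> e = (\<lambda>x. (0, x))" for f e z
  proof -
    have bl: "bounded_linear (\<lambda>z. f (P (e z)))"
      using f e by (auto intro!: bounded_linear_compose[OF bounded_linear_fst]
          bounded_linear_compose[OF bounded_linear_snd] bounded_linear_compose[OF P_lin]
          bounded_linear_Pair bounded_linear_ident bounded_linear_zero)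
    have sc: "f (P (e (c *\<^sub>C z))) = c *\<^sub>C f (P (e z))" for c z
      using f e P_scale[of c z 0] P_scale[of c 0 z] by (auto simp: scaleC_zero_right)
    define T where "T = Bop (\<lambda>z. f (P (e z)))"
    have T: "app T z = f (P (e z))" for z
      unfolding T_def by (simp add: Bop_app[OF bl sc])
    have "T \<in> commutant A"
      unfolding commutant_def
    proof (safe intro!: bop_eqI)
      fix R z assume R: "R \<in> A"
      have "f (P (e (app R z))) = app R (f (P (e z)))"
        using f e P_L[of R "e z"] L_A R adjA by (auto simp: L_def)
      then show "app (R * T) z = app (T * R) z" by (simp add: T)
    qed
    then have "T * S = S * T" using S by (auto simp: commutant_def)
    then have "app (T * S) z = app (S * T) z" by simp
    then show ?thesis by (simp add: T)
  qed
  have "(x, y) \<in> V"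
    unfolding V_def using unital_subalgebraD(1)[OF A]
    by (force intro!: subsetD[OF closure_subset])
  then have Pxy: "P (x, y) = (x, y)" by (intro P_eqI) auto
  have split: "P (a, b) = P (a, 0) + P (0, b)" for a b
    using P_add[of "(a, 0)" "(0, b)"] by simp
  have xy: "fst (P (x, 0)) + fst (P (0, y)) = x" "snd (P (x, 0)) + snd (P (0, y)) = y"
    using Pxy split[of x y] by (metis fst_add fst_conv, metis snd_add snd_conv)
  have "fst (P (app S x, app S y)) = app S (fst (P (x, 0)) + fst (P (0, y)))"
    using comm[of fst "\<lambda>x. (x, 0)" x] comm[of fst "\<lambda>x. (0, x)" y] split[of "app S x" "app S y"]
    by (simp add: app_add)
  moreover have "snd (P (app S x, app S y)) = app S (snd (P (x, 0)) + snd (P (0, y)))"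
    using comm[of snd "\<lambda>x. (x, 0)" x] comm[of snd "\<lambda>x. (0, x)" y] split[of "app S x" "app S y"]
    by (simp add: app_add)
  ultimately have "P (app S x, app S y) = (app S x, app S y)" unfolding xy 
    by (simp add: prod_eq_iff)
  then show ?thesis using PV V_def by metis
qed

text \<open>Sending T to (T x, adj T y) is real linear, so a failure of approximation would show in
  a nonzero residual (p, q) orthogonal to the range. Moving the adjoint across turns this
  orthogonality into a condition on T x and T q alone, and strong approximation at x and q carries
  it over to S.\<close>

lemma bicommutant_strong_star:
  assumes A: "unital_subalgebra A" and adjA: "\<And>T. T \<in> A \<Longrightarrow> adj T \<in> A"
    and S: "S \<in> commutant (commutant A)" and e: "e > 0"
  shows "\<exists>T\<in>A. norm (app (S - T) x) < e \<and> norm (app (adj (S - T)) y) < e"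
proof -
  let ?W = "(\<lambda>T. (app T x, app (adj T) y)) ` A"
  have subW: "subspace ?W"
  proof (unfold subspace_def, intro conjI ballI allI)
    show "0 \<in> ?W" using unital_subalgebraD(5)[OF A]
      by (intro image_eqI[of _ _ 0]) (simp_all add: zero_prod_def)
    show "u + v \<in> ?W" if uv: "u \<in> ?W" "v \<in> ?W" for u v
    proof -
      obtain F G where "F \<in> A" "G \<in> A" "u = (app F x, app (adj F) y)" "v = (app G x, app (adj G) y)"
        using uv by auto
      then show ?thesis using unital_subalgebraD(2)[OF A]
        by (intro image_eqI[of _ _ "F + G"]) auto
    qed
    show "r *\<^sub>R u \<in> ?W" if u: "u \<in> ?W" for r u
    proof -
      obtain F where "F \<in> A" "u = (app F x, app (adj F) y)" using u by auto
      then show ?thesis using unital_subalgebraD(8)[OF A]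
        by (intro image_eqI[of _ _ "r *\<^sub>R F"]) auto
    qed
  qed
  let ?s = "(app S x, app (adj S) y)"
  obtain v where v: "v \<in> closure ?W" and o: "\<forall>w\<in>closure ?W. inner (?s - v) w = 0"
    using orthogonal_projection_exists[OF subspace_closure[OF subW] closed_closure, of ?s] by blast
  obtain p q where pq: "?s - v = (p, q)" by (cases "?s - v")
  have z: "inner p (app T x) + inner (app T q) y = 0" if "T \<in> A" for T
    using bspec[OF o, of "(app T x, app (adj T) y)"] subsetD[OF closure_subset[of ?W]] that
    by (auto simp: pq inner_adj)
  have "(app S x, app S q) \<in> closure ((\<lambda>T. (app T x, app T q)) ` A)"
    by (rule bicommutant_pair[OF A adjA S])
  then obtain f where f: "\<And>n. f n \<in> (\<lambda>T. (app T x, app T q)) ` A" "f \<longlonglongrightarrow> (app S x, app S q)"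
    unfolding closure_sequential by blast
  have "(\<lambda>n. inner p (fst (f n)) + inner (snd (f n)) y) \<longlonglongrightarrow> inner p (app S x) + inner (app S q) y"
    using f(2) by (auto intro!: tendsto_intros dest: tendsto_fst tendsto_snd)
  moreover have "inner p (fst (f n)) + inner (snd (f n)) y = 0" for n
    using f(1)[of n] z by auto
  ultimately have "inner p (app S x) + inner (app S q) y = 0" by (simp add: LIMSEQ_const_iff)
  then have "inner (?s - v) ?s = 0" by (simp add: pq inner_adj)
  then have "inner (?s - v) (?s - v) = 0" using bspec[OF o v] by (simp add: inner_diff_right)
  then have "?s \<in> closure ?W" using v by simp
  then obtain T where T: "T \<in> A" "dist (app T x, app (adj T) y) ?s < e"
    using e unfolding closure_approachable by blast
  then have "dist (app T x) (app S x) < e" "dist (app (adj T) y) (app (adj S) y) < e"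
    using dist_fst_le[of "(app T x, app (adj T) y)" ?s]
      dist_snd_le[of "(app T x, app (adj T) y)" ?s] by auto
  then show ?thesis using T(1) by (auto simp: dist_norm norm_minus_commute intro!: bexI[of _ T])
qed

section \<open>Positive operators and increasing sequences\<close>

lemma positive_op_inner: "positive_op T \<Longrightarrow> 0 \<le> inner (app T x) x"
  by (simp add: positive_op_def complex_nonneg_Reals_iff Re_cinner)

lemma quadratic_form_zero:
  assumes z: "\<And>x. cinner (app D x) x = 0"
  shows "D = 0"
proof -
  have "cinner (app D x) y = 0" for x y
  proof -
    have 1: "cinner (app D x) y + cinner (app D y) x = 0"
      using z[of "x + y"] by (simp add: app_add cinner_add_left cinner_add_right z add.commute)
    have "cinner (app D x) (\<i> *\<^sub>C y) + cinner (app D (\<i> *\<^sub>C y)) x = 0"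
      using z[of "x + \<i> *\<^sub>C y"] z[of "\<i> *\<^sub>C y"]
      by (simp add: app_add cinner_add_left cinner_add_right z add.commute)
    then have "- \<i> * (cinner (app D x) y - cinner (app D y) x) = 0"
      by (simp add: app_scaleC cinner_scaleC_left cinner_scaleC_right algebra_simps)
    then have "cinner (app D x) y = cinner (app D y) x" by simp
    with 1 show ?thesis by simp
  qed
  then have "cinner z (app D x) = cinner z 0" for z x by (metis cinner_commute cinner_zero(2) complex_cnj_zero)
  then show ?thesis by (intro bop_eqI) (metis app_bop_simps(1) cinner_eqI)
qed

lemma positive_op_adj: "adj T = T" if "positive_op T"
proof -
  have "cinner (app (T - adj T) x) x = 0" for x
  proof -
    have "cinner (app T x) x \<in> \<real>" using that nonneg_Reals_subset_Reals by (auto simp: positive_op_def)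
    moreover have "cinner (app (adj T) x) x = cnj (cinner (app T x) x)"
      by (simp add: cinner_adj' cinner_commute[of x "app T x"])
    ultimately show ?thesis by (simp add: cinner_diff_left Reals_cnj_iff)
  qed
  from quadratic_form_zero[OF this] show ?thesis by simp
qed

lemma positive_op_0 [simp]: "positive_op 0"
  by (simp add: positive_op_def)

lemma positive_op_add: "positive_op S \<Longrightarrow> positive_op T \<Longrightarrow> positive_op (S + T)"
  by (simp add: positive_op_def cinner_add_left nonneg_Reals_add_I)

lemma positive_op_scaleR: "positive_op T \<Longrightarrow> 0 \<le> r \<Longrightarrow> positive_op (r *\<^sub>R T)"
  by (simp add: positive_op_def scaleC_of_real[symmetric] cinner_scaleC_left nonneg_Reals_mult_I)

lemma positive_op_conj: "positive_op T \<Longrightarrow> positive_op (adj S * T * S)"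
  by (simp add: positive_op_def cinner_adj')

lemma cinner_self: "cinner y y = complex_of_real ((norm (y::'h::complex_hilbert))\<^sup>2)"
proof -
  have "cinner y y = cnj (cinner y y)" by (rule cinner_commute)
  then have "Im (cinner y y) = 0" by (metis Reals_cnj_iff complex_is_Real_iff)
  then show ?thesis by (simp add: complex_eq_iff Re_cinner power2_norm_eq_inner)
qed

lemma positive_op_square: "positive_op (adj S * S)"
  by (simp add: positive_op_def cinner_adj' cinner_self del: of_real_power)

lemma op_le_refl: "T \<preceq> T"
  by (simp add: op_le_def)

lemma op_le_trans: "R \<preceq> S \<Longrightarrow> S \<preceq> T \<Longrightarrow> R \<preceq> T"
  using positive_op_add[of "S - R" "T - S"] by (simp add: op_le_def)

lemma op_le_0: "0 \<preceq> T \<longleftrightarrow> positive_op T"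
  by (simp add: op_le_def)

lemma op_le_add_mono: "R \<preceq> S \<Longrightarrow> T + R \<preceq> T + S"
  by (simp add: op_le_def)

lemma op_le_inner: "S \<preceq> T \<Longrightarrow> inner (app S x) x \<le> inner (app T x) x"
  using positive_op_inner[of "T - S" x] by (simp add: op_le_def inner_diff_left)

lemma square_op_le:
  assumes "\<And>x. norm (app S x) \<le> K * norm x"
  shows "adj S * S \<preceq> K\<^sup>2 *\<^sub>R 1"
  unfolding op_le_def positive_op_def
proof
  fix x
  have "cinner (app (K\<^sup>2 *\<^sub>R 1 - adj S * S) x) x = of_real ((K * norm x)\<^sup>2 - (norm (app S x))\<^sup>2)"
    by (simp add: cinner_diff_left cinner_adj' scaleC_of_real[symmetric] cinner_scaleC_left
        cinner_self power_mult_distrib)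
  moreover have "(norm (app S x))\<^sup>2 \<le> (K * norm x)\<^sup>2" by (intro power_mono assms) simp
  ultimately show "cinner (app (K\<^sup>2 *\<^sub>R 1 - adj S * S) x) x \<in> \<real>\<^sub>\<ge>\<^sub>0"
    by (metis diff_ge_0_iff_ge nonneg_Reals_of_real_iff)
qed

text \<open>Evaluate the positive form of X at x - (1/K) X x; the step 1/K matches the bound of the
  form of X by K. The result plays the role of X^2 \<le> K X and avoids square roots of
  operators.\<close>

lemma positive_norm_bound:
  assumes X: "positive_op X" and le: "X \<preceq> R" and K: "K > 0" "\<And>y. norm (app R y) \<le> K * norm y"
  shows "(norm (app X x))\<^sup>2 \<le> K * inner (app X x) x"
proof -
  define b where "b = (norm (app X x))\<^sup>2"
  define y where "y = app X x"
  have sym: "inner (app X u) v = inner u (app X v)" for u v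
    using inner_adj[of X u v] positive_op_adj[OF X] by simp
  have "inner (app X y) y \<le> inner (app R y) y" using op_le_inner[OF le] .
  also have "\<dots> \<le> norm (app R y) * norm y" by (rule norm_cauchy_schwarz)
  also have "\<dots> \<le> K * norm y * norm y" by (intro mult_right_mono K) simp
  finally have c: "inner (app X y) y \<le> K * b" by (simp add: b_def y_def power2_eq_square)
  have yx: "inner y (app X x) = b" "inner (app X x) y = b"
    by (simp_all add: y_def b_def power2_norm_eq_inner)
  have "0 \<le> inner (app X (x - (1/K) *\<^sub>R y)) (x - (1/K) *\<^sub>R y)" by (rule positive_op_inner[OF X])
  also have "\<dots> = inner (app X x) x - 1/K * inner (app X x) y - 1/K * inner (app X y) x
      + 1/K * (1/K * inner (app X y) y)"
    by (simp only: app_diff app_scaleR inner_diff_left inner_diff_right inner_scaleR_left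
        inner_scaleR_right right_diff_distrib)
  also have "\<dots> = inner (app X x) x - 2 * b / K + inner (app X y) y / K\<^sup>2"
    using yx sym[of y x] by (simp add: power2_eq_square)
  also have "\<dots> \<le> inner (app X x) x - 2 * b / K + K * b / K\<^sup>2"
    using c by (intro add_left_mono divide_right_mono) simp_all
  also have "\<dots> = inner (app X x) x - b / K" using K(1) by (simp add: power2_eq_square)
  finally show ?thesis using K(1) by (simp add: b_def field_simps)
qed

lemma positive_norm_le:
  assumes X: "positive_op X" and le: "X \<preceq> R" and K: "K > 0" "\<And>y. norm (app R y) \<le> K * norm y"
  shows "norm (app X x) \<le> K * norm x"
proof -
  have "(norm (app X x))\<^sup>2 \<le> K * (norm (app X x) * norm x)"
    using positive_norm_bound[OF assms, of x] norm_cauchy_schwarz[of "app X x" x] K(1)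
    by (meson mult_left_mono less_imp_le order_trans)
  then show ?thesis using K(1) by (cases "app X x = 0") (auto simp: power2_eq_square)
qed

section \<open>Strong limits of increasing sequences\<close>

lemma tendsto_cinner_left: "f \<longlonglongrightarrow> l \<Longrightarrow> (\<lambda>n. cinner (f n) y) \<longlonglongrightarrow> cinner l y"
  unfolding cinner_conv_inner inner_scaleC_left by (intro tendsto_intros)

lemma positive_op_limit:
  assumes "\<And>x. (\<lambda>n. app (S n) x) \<longlonglongrightarrow> app T x" "\<And>n. positive_op (S n)"
  shows "positive_op T"
  unfolding positive_op_def
proof
  fix x
  show "cinner (app T x) x \<in> \<real>\<^sub>\<ge>\<^sub>0"
    using closed_sequentially[OF closed_nonneg_Reals_complex, of "\<lambda>n. cinner (app (S n) x) x"]
      tendsto_cinner_left[OF assms(1)] assms(2) by (auto simp: positive_op_def)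
qed

lemma op_le_chain:
  assumes "\<And>n. S n \<preceq> S (Suc n)" "m \<le> n"
  shows "S m \<preceq> S n"
  using assms(2) by (induction rule: dec_induct) (auto intro: op_le_refl op_le_trans assms(1))

lemma commutant_limit:
  assumes "\<And>x. (\<lambda>n. app (S n) x) \<longlonglongrightarrow> app T x" "\<And>n. S n \<in> commutant B"
  shows "T \<in> commutant B"
  unfolding commutant_def
proof (safe intro!: bop_eqI)
  fix R x assume R: "R \<in> B"
  have "app (S n) (app R x) = app R (app (S n) x)" for n
    using assms(2)[of n] R by (metis (mono_tags, lifting) app_bop_simps(7) commutant_def mem_Collect_eq)
  then have "(\<lambda>n. app R (app (S n) x)) \<longlonglongrightarrow> app T (app R x)" using assms(1)[of "app R x"] by simp
  moreover have "(\<lambda>n. app R (app (S n) x)) \<longlonglongrightarrow> app R (app T x)"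
    by (rule tendsto_app[OF assms(1)])
  ultimately show "app (R * T) x = app (T * R) x" by (simp add: LIMSEQ_unique)
qed

text \<open>Bounded monotone quadratic forms converge, and \<open>positive_norm_bound\<close> for S
  n - S m turns their Cauchy property into that of the vectors S n x. So the limit is strong and not
  only a limit of forms.\<close>

lemma increasing_limit:
  assumes pos: "\<And>n. positive_op (S n)" and inc: "\<And>n. S n \<preceq> S (Suc n)" and le: "\<And>n. S n \<preceq> R"
  obtains T where "\<And>x. (\<lambda>n. app (S n) x) \<longlonglongrightarrow> app T x"
proof -
  obtain K where K: "K > 0" "\<And>x. norm (app R x) \<le> K * norm x" using app_bound by blast
  note ch = op_le_chain[of S, OF inc]
  have bd: "(norm (app (S n) x - app (S m) x))\<^sup>2 \<le> K * (inner (app (S n) x) x - inner (app (S m) x) x)"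
    if mn: "m \<le> n" for m n x
  proof -
    have "S n - S m \<preceq> S n" using pos[of m] by (simp add: op_le_def)
    then have "S n - S m \<preceq> R" using le op_le_trans by blast
    moreover have "positive_op (S n - S m)" using ch[OF mn] by (simp add: op_le_def)
    ultimately show ?thesis
      using positive_norm_bound[of "S n - S m" R K x] K by (simp add: inner_diff_left)
  qed
  have conv: "\<exists>l. (\<lambda>n. app (S n) x) \<longlonglongrightarrow> l" for x
  proof -
    let ?a = "\<lambda>n. inner (app (S n) x) x"
    have "incseq ?a" by (auto simp: incseq_def intro!: op_le_inner ch)
    moreover have "?a n \<le> inner (app R x) x" for n using le op_le_inner by blast
    ultimately obtain l where "?a \<longlonglongrightarrow> l" using incseq_convergent by blast
    then have Ca: "Cauchy ?a" by (simp add: LIMSEQ_imp_Cauchy)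
    have "Cauchy (\<lambda>n. app (S n) x)"
    proof (rule metric_CauchyI)
      fix e :: real assume e: "0 < e"
      then obtain N where N: "\<And>m n. m \<ge> N \<Longrightarrow> n \<ge> N \<Longrightarrow> dist (?a m) (?a n) < e\<^sup>2 / K"
        using metric_CauchyD[OF Ca, of "e\<^sup>2 / K"] K(1) by auto
      have *: "dist (app (S n) x) (app (S m) x) < e" if "m \<le> n" "N \<le> m" for m n
      proof -
        have "?a n - ?a m < e\<^sup>2 / K" using N[of m n] that by (auto simp: dist_real_def)
        then have "K * (?a n - ?a m) < e\<^sup>2" using K(1) by (simp add: field_simps)
        then have "(norm (app (S n) x - app (S m) x))\<^sup>2 < e\<^sup>2" using bd[OF that(1), of x] by linarith
        then show ?thesis using e by (simp add: dist_norm power_less_imp_less_base)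
      qed
      show "\<exists>M. \<forall>m\<ge>M. \<forall>n\<ge>M. dist (app (S m) x) (app (S n) x) < e"
      proof (intro exI allI impI)
        fix m n assume "N \<le> m" "N \<le> n"
        then show "dist (app (S m) x) (app (S n) x) < e"
          using *[of m n] *[of n m] by (cases "m \<le> n") (auto simp: dist_commute)
      qed
    qed
    then show ?thesis using Cauchy_convergent convergent_def by blast
  qed
  then obtain f where f: "\<And>x. (\<lambda>n. app (S n) x) \<longlonglongrightarrow> f x" by metis
  have "f (x + y) = f x + f y" for x y
    using LIMSEQ_unique[OF f[of "x + y"]] tendsto_add[OF f[of x] f[of y]] by (simp add: app_add)
  moreover have fc: "f (c *\<^sub>C x) = c *\<^sub>C f x" for c x
    using LIMSEQ_unique[OF f[of "c *\<^sub>C x"]] bounded_linear.tendsto[OF bounded_linear_scaleC f[of x], of c]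
    by (simp add: app_scaleC)
  moreover have "norm (f x) \<le> norm x * K" for x
  proof (rule LIMSEQ_le_const2[OF tendsto_norm[OF f]])
    show "\<exists>N. \<forall>n\<ge>N. norm (app (S n) x) \<le> norm x * K"
      using positive_norm_le[OF pos le K] by (auto simp: mult.commute)
  qed
  ultimately have "bounded_linear f"
    by (intro bounded_linear_intro[where K = K]) (simp_all flip: scaleC_of_real)
  then show thesis using that[of "Bop f"] f Bop_app[OF _ fc] by simp
qed

lemma increasing_limit_upper:
  assumes inc: "\<And>n. S n \<preceq> S (Suc n)" and T: "\<And>x. (\<lambda>n. app (S n) x) \<longlonglongrightarrow> app T x"
  shows "S n \<preceq> T"
  unfolding op_le_def
proof (rule positive_op_limit)
  show "(\<lambda>k. app (S (k + n) - S n) x) \<longlonglongrightarrow> app (T - S n) x" for x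
    using LIMSEQ_ignore_initial_segment[OF T] by (auto intro!: tendsto_intros)
  show "positive_op (S (k + n) - S n)" for k
    using op_le_chain[of S n "k + n", OF inc] by (simp add: op_le_def)
qed

lemma limit_op_le:
  assumes T: "\<And>x. (\<lambda>n. app (S n) x) \<longlonglongrightarrow> app T x" and le: "\<And>n. S n \<preceq> U"
  shows "T \<preceq> U"
  unfolding op_le_def
proof (rule positive_op_limit)
  show "(\<lambda>n. app (U - S n) x) \<longlonglongrightarrow> app (U - T) x" for x
    using T by (auto intro!: tendsto_intros)
  show "positive_op (U - S n)" for n using le by (simp add: op_le_def)
qed

section \<open>Von Neumann algebras with a faithful normal trace\<close>

lemma unital_subalgebra_commutant: "unital_subalgebra (commutant B)"
  unfolding unital_subalgebra_def commutant_def
  by (auto simp: distrib_left distrib_right scaleC_mult_left scaleC_mult_right mult.assoc)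
    (metis mult.assoc)

lemma vn_unital_subalgebra: "von_neumann_algebra M \<Longrightarrow> unital_subalgebra M"
  using unital_subalgebra_commutant[of "commutant M"] by (simp add: von_neumann_algebra_def)

lemma positive_opI:
  assumes "adj T = T" "\<And>x. 0 \<le> inner (app T x) x"
  shows "positive_op T"
  unfolding positive_op_def
proof
  fix x
  have "cinner (app T x) x = cnj (cinner (app T x) x)"
    using cinner_adj[of T x x] assms(1) cinner_commute[of x "app T x"] by simp
  then have "Im (cinner (app T x) x) = 0" by (metis Reals_cnj_iff complex_is_Real_iff)
  then show "cinner (app T x) x \<in> \<real>\<^sub>\<ge>\<^sub>0"
    using assms(2)[of x] by (simp add: complex_nonneg_Reals_iff Re_cinner)
qed

lemma app_adj_bound:
  assumes K: "K > 0" "\<And>x. norm (app T x) \<le> K * norm x"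
  shows "norm (app (adj T) x) \<le> K * norm x"
proof -
  let ?y = "app (adj T) x"
  have "(norm ?y)\<^sup>2 = inner (app T ?y) x" by (simp add: inner_adj power2_norm_eq_inner)
  also have "\<dots> \<le> norm (app T ?y) * norm x" by (rule norm_cauchy_schwarz)
  also have "\<dots> \<le> K * norm ?y * norm x" by (intro mult_right_mono K) simp
  finally show ?thesis using K(1) by (cases "?y = 0") (auto simp: power2_eq_square)
qed

locale tracial_vn =
  fixes M :: "'h::complex_hilbert bop set" and \<tau> :: "'h bop \<Rightarrow> complex"
  assumes vN: "von_neumann_algebra M" and trace: "trace_state M \<tau>"
    and faithful: "faithful_on M \<tau>" and normal: "normal_on M \<tau>"
begin

lemmas M_closed [simp, intro] = unital_subalgebraD[OF vn_unital_subalgebra[OF vN]]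

lemma M_adj [simp, intro]: "T \<in> M \<Longrightarrow> adj T \<in> M"
  using vN by (simp add: von_neumann_algebra_def)

lemma M_limit:
  assumes "\<And>x. (\<lambda>n. app (S n) x) \<longlonglongrightarrow> app T x" "\<And>n. S n \<in> M"
  shows "T \<in> M"
  using commutant_limit[of S T "commutant M"] assms vN by (simp add: von_neumann_algebra_def)

lemma tr_add: "S \<in> M \<Longrightarrow> T \<in> M \<Longrightarrow> \<tau> (S + T) = \<tau> S + \<tau> T"
  using trace by (simp add: trace_state_def)

lemma tr_scale: "T \<in> M \<Longrightarrow> \<tau> (c *\<^sub>C T) = c * \<tau> T"
  using trace by (simp add: trace_state_def)

lemma tr_0 [simp]: "\<tau> 0 = 0"
  using tr_scale[of 0 0] by simp

lemma tr_1 [simp]: "\<tau> 1 = 1"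
  using trace by (simp add: trace_state_def)

lemma tr_diff: "S \<in> M \<Longrightarrow> T \<in> M \<Longrightarrow> \<tau> (S - T) = \<tau> S - \<tau> T"
  using tr_add[of "S - T" T] by simp

lemma tr_scaleR: "T \<in> M \<Longrightarrow> \<tau> (r *\<^sub>R T) = complex_of_real r * \<tau> T"
  unfolding scaleR_bop_def by (rule tr_scale)

lemma tr_commute: "S \<in> M \<Longrightarrow> T \<in> M \<Longrightarrow> \<tau> (S * T) = \<tau> (T * S)"
  using trace by (simp add: trace_state_def)

lemma tr_sum: "(\<And>i. i \<in> I \<Longrightarrow> f i \<in> M) \<Longrightarrow> \<tau> (sum f I) = (\<Sum>i\<in>I. \<tau> (f i)) \<and> sum f I \<in> M"
  by (induction I rule: infinite_finite_induct) (auto simp: tr_add)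

lemma tr_positive:
  assumes "T \<in> M" "positive_op T"
  shows "0 \<le> Re (\<tau> T)" "Im (\<tau> T) = 0"
  using trace assms by (auto simp: trace_state_def complex_nonneg_Reals_iff)

lemma tr_mono: "S \<in> M \<Longrightarrow> T \<in> M \<Longrightarrow> S \<preceq> T \<Longrightarrow> Re (\<tau> S) \<le> Re (\<tau> T)"
  using tr_positive(1)[of "T - S"] by (simp add: op_le_def tr_diff)

lemma tr_eq_imp_eq:
  assumes "S \<in> M" "T \<in> M" "S \<preceq> T" "Re (\<tau> T) \<le> Re (\<tau> S)"
  shows "T = S"
proof -
  have "T - S \<in> M" "positive_op (T - S)" using assms by (auto simp: op_le_def)
  moreover from this have "\<tau> (T - S) = 0"
    using tr_positive[of "T - S"] assms by (simp add: complex_eq_iff tr_diff)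
  ultimately have "T - S = 0" using faithful by (auto simp: faithful_on_def)
  then show ?thesis by simp
qed

text \<open>The strong limit of an increasing sequence is its least upper bound among the hermitian
  elements of M, so normality applies to the directed set of its terms.\<close>

lemma tr_limit:
  assumes M: "\<And>n. S n \<in> M" and pos: "\<And>n. positive_op (S n)" and inc: "\<And>n. S n \<preceq> S (Suc n)"
    and T: "\<And>x. (\<lambda>n. app (S n) x) \<longlonglongrightarrow> app T x"
  shows "(\<lambda>n. Re (\<tau> (S n))) \<longlonglongrightarrow> Re (\<tau> T)"
proof -
  have TM: "T \<in> M" by (rule M_limit[OF T M])
  have posT: "positive_op T" by (rule positive_op_limit[OF T pos])
  have up: "S n \<preceq> T" for n by (rule increasing_limit_upper[OF inc T])
  have herm: "range S \<subseteq> hermitian_part M"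
    using M pos by (auto simp: hermitian_part_def positive_op_adj)
  have dir: "\<forall>P\<in>range S. \<forall>Q\<in>range S. \<exists>U\<in>range S. P \<preceq> U \<and> Q \<preceq> U"
  proof (safe, goal_cases)
    case (1 _ m _ n)
    then show ?case
      using op_le_chain[of S m "max m n"] op_le_chain[of S n "max m n"] inc by auto
  qed
  have lub: "is_lub_in (hermitian_part M) (range S) T"
    unfolding is_lub_in_def
    using up TM posT limit_op_le[OF T] by (auto simp: hermitian_part_def positive_op_adj)
  have eq: "Re (\<tau> T) = (SUP P\<in>range S. Re (\<tau> P))"
    using normal herm dir lub unfolding normal_on_def by blast
  have "(\<lambda>n. Re (\<tau> (S n))) \<longlonglongrightarrow> (SUP n. Re (\<tau> (S n)))"
  proof (rule LIMSEQ_incseq_SUP)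
    show "bdd_above (range (\<lambda>n. Re (\<tau> (S n))))"
      using tr_mono[OF M TM up] by (intro bdd_aboveI2)
    show "incseq (\<lambda>n. Re (\<tau> (S n)))" by (intro incseq_SucI tr_mono M inc)
  qed
  then show ?thesis by (simp add: eq image_comp comp_def)
qed

text \<open>A greedy choice of an increasing sequence replaces Zorn's lemma here, since the faithful trace
  measures the progress.\<close>

lemma maximal_element_exists:
  assumes R: "R \<in> M" and D: "\<And>S. S \<in> D \<Longrightarrow> S \<in> M \<and> positive_op S \<and> S \<preceq> R" and ne: "D \<noteq> {}"
    and lim: "\<And>S T. (\<And>n. S n \<in> D) \<Longrightarrow> (\<And>n. S n \<preceq> S (Suc n)) \<Longrightarrow>
      (\<And>x. (\<lambda>n. app (S n) x) \<longlonglongrightarrow> app T x) \<Longrightarrow> T \<in> D"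
  shows "\<exists>P\<in>D. \<forall>S\<in>D. P \<preceq> S \<longrightarrow> S = P"
proof -
  let ?t = "\<lambda>S. Re (\<tau> S)"
  \<comment> \<open>Some P' above P realizes at least half of the gain in trace still possible
    within \<open>D\<close>.\<close>
  have step: "\<exists>P'\<in>D. P \<preceq> P' \<and> (\<forall>S\<in>D. P \<preceq> S \<longrightarrow> ?t S - ?t P \<le> 2 * (?t P' - ?t P))"
    if P: "P \<in> D" for P
  proof -
    define C where "C = {S \<in> D. P \<preceq> S}"
    define s where "s = (SUP S\<in>C. ?t S)"
    have bdd: "bdd_above (?t ` C)"
      using D R by (intro bdd_aboveI2[of _ _ "?t R"] tr_mono) (auto simp: C_def)
    have PC: "P \<in> C" using P by (simp add: C_def op_le_refl)
    have up: "?t S \<le> s" if "S \<in> C" for S unfolding s_def by (rule cSUP_upper[OF that bdd])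
    show ?thesis
    proof (cases "s = ?t P")
      case True
      then show ?thesis using P up by (intro bexI[of _ P]) (auto simp: C_def op_le_refl)
    next
      case False
      then have "(s + ?t P) / 2 < s" using up[OF PC] by simp
      then obtain P' where P': "P' \<in> C" "(s + ?t P) / 2 < ?t P'"
        unfolding s_def using less_cSUP_iff[OF _ bdd] PC by blast
      have "?t S - ?t P \<le> 2 * (?t P' - ?t P)" if "S \<in> C" for S
        using up[OF that] P'(2) by (simp add: field_simps)
      then show ?thesis using P'(1) by (auto simp: C_def)
    qed
  qed
  then obtain nxt where nxt: "\<And>P. P \<in> D \<Longrightarrow> nxt P \<in> D" "\<And>P. P \<in> D \<Longrightarrow> P \<preceq> nxt P"
    "\<And>P S. P \<in> D \<Longrightarrow> S \<in> D \<Longrightarrow> P \<preceq> S \<Longrightarrow> ?t S - ?t P \<le> 2 * (?t (nxt P) - ?t P)"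
    by metis
  obtain P0 where P0: "P0 \<in> D" using ne by blast
  define p where "p n = (nxt ^^ n) P0" for n
  have pD: "p n \<in> D" for n by (induction n) (auto simp: p_def P0 nxt(1))
  have p_Suc: "p (Suc n) = nxt (p n)" for n by (simp add: p_def)
  have inc: "p n \<preceq> p (Suc n)" for n using nxt(2)[OF pD] by (simp add: p_Suc)
  have pM: "p n \<in> M" and ppos: "positive_op (p n)" and pR: "p n \<preceq> R" for n using D pD by auto
  obtain T where T: "\<And>x. (\<lambda>n. app (p n) x) \<longlonglongrightarrow> app T x"
    using increasing_limit[of p R, OF ppos inc pR] by blast
  have TD: "T \<in> D" by (rule lim[OF pD inc T])
  have tl: "(\<lambda>n. ?t (p n)) \<longlonglongrightarrow> ?t T" by (rule tr_limit[OF pM ppos inc T])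
  have "S = T" if S: "S \<in> D" and TS: "T \<preceq> S" for S
  proof (rule tr_eq_imp_eq)
    \<comment> \<open>An S above the limit lies above every \<open>p n\<close>. The gains of the
      sequence tend to 0, so S has no larger trace than T, and faithfulness gives equality.\<close>
    have "?t S - ?t (p n) \<le> 2 * (?t (p (Suc n)) - ?t (p n))" for n
      unfolding p_Suc using nxt(3)[OF pD S] op_le_trans[OF increasing_limit_upper[OF inc T] TS] by blast
    moreover have "(\<lambda>n. ?t S - ?t (p n)) \<longlonglongrightarrow> ?t S - ?t T" by (intro tendsto_intros tl)
    moreover have "(\<lambda>n. 2 * (?t (p (Suc n)) - ?t (p n))) \<longlonglongrightarrow> 2 * (?t T - ?t T)"
      by (intro tendsto_intros LIMSEQ_Suc[OF tl] tl)
    ultimately have "?t S - ?t T \<le> 2 * (?t T - ?t T)" by (meson LIMSEQ_le)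
    then show "?t S \<le> ?t T" by simp
  qed (use S TD D TS in auto)
  with TD show ?thesis by blast
qed

section \<open>The trace inner product\<close>

definition ip :: "'h bop \<Rightarrow> 'h bop \<Rightarrow> complex" where "ip S T = \<tau> (adj T * S)"

definition tnorm :: "'h bop \<Rightarrow> real" where "tnorm S = sqrt (Re (ip S S))"

lemma ip_add_left: "R \<in> M \<Longrightarrow> S \<in> M \<Longrightarrow> T \<in> M \<Longrightarrow> ip (R + S) T = ip R T + ip S T"
  by (simp add: ip_def distrib_left tr_add)

lemma ip_add_right: "R \<in> M \<Longrightarrow> S \<in> M \<Longrightarrow> T \<in> M \<Longrightarrow> ip T (R + S) = ip T R + ip T S"
  by (simp add: ip_def distrib_right tr_add)

lemma ip_diff_left: "R \<in> M \<Longrightarrow> S \<in> M \<Longrightarrow> T \<in> M \<Longrightarrow> ip (R - S) T = ip R T - ip S T"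
  by (simp add: ip_def right_diff_distrib tr_diff)

lemma ip_diff_right: "R \<in> M \<Longrightarrow> S \<in> M \<Longrightarrow> T \<in> M \<Longrightarrow> ip T (R - S) = ip T R - ip T S"
  by (simp add: ip_def left_diff_distrib tr_diff)

lemma ip_scale_left: "S \<in> M \<Longrightarrow> T \<in> M \<Longrightarrow> ip (c *\<^sub>C S) T = c * ip S T"
  by (simp add: ip_def scaleC_mult_right tr_scale)

lemma ip_scale_right: "S \<in> M \<Longrightarrow> T \<in> M \<Longrightarrow> ip S (c *\<^sub>C T) = cnj c * ip S T"
  by (simp add: ip_def scaleC_mult_left tr_scale)

lemma ip_self: "S \<in> M \<Longrightarrow> ip S S = complex_of_real ((tnorm S)\<^sup>2)"
  using tr_positive[of "adj S * S"] positive_op_square[of S]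
  by (simp add: ip_def tnorm_def complex_eq_iff)

lemma tnorm_nonneg [simp]: "S \<in> M \<Longrightarrow> 0 \<le> tnorm S"
  using tr_positive[of "adj S * S"] positive_op_square[of S] by (simp add: tnorm_def ip_def)

text \<open>Positivity of the trace makes \<open>ip\<close> real on the diagonal; polarization at S
  + T and S + \<i> T gives the symmetry. Compatibility of the trace with adjoints is deduced from it
  afterwards.\<close>

lemma ip_commute:
  assumes S: "S \<in> M" and T: "T \<in> M"
  shows "ip S T = cnj (ip T S)"
proof -
  have im: "Im (ip R R) = 0" if "R \<in> M" for R using ip_self[OF that] by simp
  have "Im (ip S T) + Im (ip T S) = 0"
    using im[of "S + T"] im[OF S] im[OF T] S T by (simp add: ip_add_left ip_add_right)
  moreover have "Im (ip S (\<i> *\<^sub>C T)) + Im (ip (\<i> *\<^sub>C T) S) = 0"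
    using im[of "S + \<i> *\<^sub>C T"] im[OF S] im[of "\<i> *\<^sub>C T"] S T by (simp add: ip_add_left ip_add_right)
  ultimately show ?thesis using S T by (simp add: ip_scale_left ip_scale_right complex_eq_iff)
qed

lemma tr_adj: "T \<in> M \<Longrightarrow> \<tau> (adj T) = cnj (\<tau> T)"
  using ip_commute[of 1 T] by (simp add: ip_def)

lemma ip_mult_left: "ip (R * S) T = ip S (adj R * T)"
  by (simp add: ip_def mult.assoc)

lemma tnorm_diff_scale:
  assumes S: "S \<in> M" and T: "T \<in> M"
  shows "(tnorm (S - c *\<^sub>C T))\<^sup>2 = (tnorm S)\<^sup>2 - 2 * Re (cnj c * ip S T) + (cmod c)\<^sup>2 * (tnorm T)\<^sup>2"
proof -
  have "complex_of_real ((tnorm (S - c *\<^sub>C T))\<^sup>2)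
      = ip S S - cnj c * ip S T - c * ip T S + c * cnj c * ip T T"
    using S T by (simp add: ip_self[symmetric] ip_diff_left ip_diff_right ip_scale_left
        ip_scale_right algebra_simps del: of_real_power)
  also have "ip T S = cnj (ip S T)" by (rule ip_commute[OF T S])
  also have "c * cnj c = complex_of_real ((cmod c)\<^sup>2)" by (metis complex_norm_square of_real_power)
  finally have "Re (complex_of_real ((tnorm (S - c *\<^sub>C T))\<^sup>2)) = Re (complex_of_real ((tnorm S)\<^sup>2)
      - cnj c * ip S T - c * cnj (ip S T) + complex_of_real ((cmod c)\<^sup>2) * complex_of_real ((tnorm T)\<^sup>2))"
    unfolding ip_self[OF S] ip_self[OF T] by (rule arg_cong)
  then show ?thesis by (simp del: of_real_power)
qed

lemma ip_cauchy_schwarz: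
  assumes S: "S \<in> M" and T: "T \<in> M"
  shows "cmod (ip S T) \<le> tnorm S * tnorm T"
proof -
  let ?z = "ip S T"
  have ex: "0 \<le> (tnorm S)\<^sup>2 - 2 * t * (cmod ?z)\<^sup>2 + t\<^sup>2 * (cmod ?z)\<^sup>2 * (tnorm T)\<^sup>2" for t
  proof -
    have "cnj ?z * ?z = complex_of_real ((cmod ?z)\<^sup>2)"
      by (simp add: complex_norm_square mult.commute del: of_real_power)
    then have "cnj (of_real t * ?z) * ?z = complex_of_real (t * (cmod ?z)\<^sup>2)" by simp
    then have "(tnorm (S - (of_real t * ?z) *\<^sub>C T))\<^sup>2 =
        (tnorm S)\<^sup>2 - 2 * (t * (cmod ?z)\<^sup>2) + (cmod (of_real t * ?z))\<^sup>2 * (tnorm T)\<^sup>2"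
      using tnorm_diff_scale[OF S T, of "of_real t * ?z"] by (metis Re_complex_of_real)
    then have "0 \<le> (tnorm S)\<^sup>2 - 2 * (t * (cmod ?z)\<^sup>2) + (cmod (of_real t * ?z))\<^sup>2 * (tnorm T)\<^sup>2"
      by (metis zero_le_power2)
    then show ?thesis by (simp add: norm_mult power_mult_distrib mult.assoc)
  qed
  have "(cmod ?z)\<^sup>2 \<le> (tnorm S * tnorm T)\<^sup>2"
  proof (cases "tnorm T = 0")
    case True
    have "?z = 0"
    proof (rule ccontr)
      assume z: "?z \<noteq> 0"
      \<comment> \<open>With this t the inequality \<open>ex\<close> would read 0 \<le> -1.\<close>
      define t where "t = ((tnorm S)\<^sup>2 + 1) / (2 * (cmod ?z)\<^sup>2)"
      have "2 * t * (cmod ?z)\<^sup>2 = (tnorm S)\<^sup>2 + 1" using z by (simp add: t_def)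
      then show False using ex[of t] True by simp
    qed
    then show ?thesis by simp
  next
    case False
    define b where "b = (tnorm T)\<^sup>2"
    have b: "b > 0" using False by (simp add: b_def)
    have "0 \<le> (tnorm S)\<^sup>2 - 2 * (1/b) * (cmod ?z)\<^sup>2 + (1/b)\<^sup>2 * (cmod ?z)\<^sup>2 * b"
      using ex[of "1/b"] by (simp add: b_def)
    also have "\<dots> = (tnorm S)\<^sup>2 - (cmod ?z)\<^sup>2 / b" using b by (simp add: power2_eq_square)
    finally show ?thesis using b by (simp add: b_def field_simps)
  qed
  then show ?thesis by (rule power2_le_imp_le) (use S T in simp)
qed

lemma tnorm_adj: "T \<in> M \<Longrightarrow> tnorm (adj T) = tnorm T"
  by (simp add: tnorm_def ip_def tr_commute[of T "adj T"])

lemma tnorm_mult_left: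
  assumes "R \<in> M" "T \<in> M" and K: "K > 0" "\<And>x. norm (app R x) \<le> K * norm x"
  shows "tnorm (R * T) \<le> K * tnorm T"
proof (rule power2_le_imp_le)
  have "positive_op (adj T * (K\<^sup>2 *\<^sub>R 1 - adj R * R) * T)"
    using square_op_le[OF K(2)] by (intro positive_op_conj) (simp add: op_le_def)
  moreover have eq: "adj T * (K\<^sup>2 *\<^sub>R 1 - adj R * R) * T = K\<^sup>2 *\<^sub>R (adj T * T) - adj (R * T) * (R * T)"
    by (rule bop_eqI) (simp add: app_diff app_scaleR)
  ultimately have "adj (R * T) * (R * T) \<preceq> K\<^sup>2 *\<^sub>R (adj T * T)" unfolding op_le_def by (simp only:)
  then have "Re (\<tau> (adj (R * T) * (R * T))) \<le> Re (\<tau> (K\<^sup>2 *\<^sub>R (adj T * T)))"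
    using assms(1,2) by (intro tr_mono) auto
  moreover have "Re (\<tau> (adj S * S)) = (tnorm S)\<^sup>2" if "S \<in> M" for S
    using ip_self[OF that] by (simp add: ip_def del: of_real_power)
  ultimately show "(tnorm (R * T))\<^sup>2 \<le> (K * tnorm T)\<^sup>2"
    using assms(1,2) by (simp add: tr_scaleR power_mult_distrib del: adj_simps of_real_power)
  show "0 \<le> K * tnorm T" using assms by simp
qed

text \<open>Here traciality matters: the adjoint preserves \<open>tnorm\<close>, so right
  multiplication is bounded like left multiplication.\<close>

lemma tnorm_mult_right:
  assumes "R \<in> M" "T \<in> M" and K: "K > 0" "\<And>x. norm (app R x) \<le> K * norm x"
  shows "tnorm (T * R) \<le> K * tnorm T"
  using tnorm_mult_left[of "adj R" "adj T" K] app_adj_bound[OF K] assms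
    tnorm_adj[of T] tnorm_adj[of "T * R"] by simp

section \<open>Operators dominated by a vector\<close>

text \<open>On such Q, convergence of operators T at the single vector x forces convergence of T * Q
  in \<open>tnorm\<close>, with no norm bound on the T.\<close>

definition dominated :: "'h bop \<Rightarrow> bool" where
  "dominated Q \<longleftrightarrow> Q \<in> M \<and> (\<exists>x. \<forall>T\<in>M. tnorm (T * Q) \<le> norm (app T x))"

lemma dominated_0: "dominated 0"
  by (auto simp: dominated_def tnorm_def ip_def)

lemma dominated_mult_right:
  assumes Q: "dominated Q" and R: "R \<in> M"
  shows "dominated (Q * R)"
proof -
  obtain x where x: "Q \<in> M" "\<And>T. T \<in> M \<Longrightarrow> tnorm (T * Q) \<le> norm (app T x)"
    using Q by (auto simp: dominated_def)
  obtain K where K: "K > 0" "\<And>x. norm (app R x) \<le> K * norm x" using app_bound by blast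
  have "tnorm (T * (Q * R)) \<le> norm (app T (K *\<^sub>R x))" if "T \<in> M" for T
  proof -
    have "tnorm (T * (Q * R)) \<le> K * tnorm (T * Q)"
      using tnorm_mult_right[of R "T * Q" K] x(1) R that K by (simp add: mult.assoc)
    also have "\<dots> \<le> K * norm (app T x)" using x(2)[OF that] K(1) by (intro mult_left_mono) auto
    finally show ?thesis using K(1) by (simp add: app_scaleR)
  qed
  then show ?thesis using x(1) R by (auto simp: dominated_def)
qed

text \<open>Dixmier's argument: if \<open>\<tau>(R)\<close> is smaller than \<open>\<langle>R x, x\<rangle>\<close>, then subtracting from \<open>R\<close> a maximal
  \<open>S \<le> R\<close> with \<open>\<tau>(S) \<ge> \<langle>S x, x\<rangle>\<close> leaves an operator below which \<open>\<tau>\<close> is bounded by the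
  vector functional of \<open>x\<close>.\<close>

lemma dominated_below_exists:
  assumes R: "R \<in> M" "positive_op R" "R \<noteq> 0"
  shows "\<exists>Q. dominated Q \<and> Q \<noteq> 0 \<and> positive_op Q \<and> Q \<preceq> R"
proof -
  obtain x0 where x0: "inner (app R x0) x0 > 0"
  proof (rule ccontr)
    assume "\<not> thesis"
    then have "\<not> inner (app R x) x > 0" for x using that by blast
    then have "inner (app R x) x = 0" for x
      using positive_op_inner[OF R(2), of x] by (simp add: order.antisym not_less)
    then have "cinner (app R x) x = 0" for x
      using R(2) by (auto simp: positive_op_def complex_nonneg_Reals_iff complex_eq_iff Re_cinner)
    from quadratic_form_zero[OF this] show False using R(3) by simp
  qed
  \<comment> \<open>Rescales x0 so that the form of R at x equals \<tau>(R) + 1, just above the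
    trace.\<close>
  define r where "r = sqrt ((Re (\<tau> R) + 1) / inner (app R x0) x0)"
  define x where "x = r *\<^sub>R x0"
  have "0 \<le> Re (\<tau> R)" using tr_positive R by blast
  then have "r * r = (Re (\<tau> R) + 1) / inner (app R x0) x0" using x0 by (simp add: r_def)
  then have "r * r * inner (app R x0) x0 = Re (\<tau> R) + 1" using x0 by simp
  then have x: "Re (\<tau> R) < inner (app R x) x" by (simp add: x_def app_scaleR mult.assoc)
  define D where "D = {S \<in> M. positive_op S \<and> S \<preceq> R \<and> inner (app S x) x \<le> Re (\<tau> S)}"
  have "\<exists>S\<in>D. \<forall>S'\<in>D. S \<preceq> S' \<longrightarrow> S' = S"
  proof (rule maximal_element_exists[OF R(1)])
    show "D \<noteq> {}" using R by (auto simp: D_def op_le_0 intro!: exI[of _ 0])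
    fix S T assume S: "\<And>n. S n \<in> D" "\<And>n. S n \<preceq> S (Suc n)" "\<And>x. (\<lambda>n. app (S n) x) \<longlonglongrightarrow> app T x"
    have SM: "S n \<in> M" "positive_op (S n)" "S n \<preceq> R" for n using S(1) by (auto simp: D_def)
    have "(\<lambda>n. inner (app (S n) x) x) \<longlonglongrightarrow> inner (app T x) x" by (intro tendsto_intros S(3))
    moreover have "(\<lambda>n. Re (\<tau> (S n))) \<longlonglongrightarrow> Re (\<tau> T)" by (rule tr_limit[OF SM(1,2) S(2,3)])
    ultimately have "inner (app T x) x \<le> Re (\<tau> T)"
      by (rule LIMSEQ_le) (use S(1) in \<open>auto simp: D_def\<close>)
    then show "T \<in> D"
      using M_limit[OF S(3) SM(1)] positive_op_limit[OF S(3) SM(2)] limit_op_le[OF S(3) SM(3)]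
      by (simp add: D_def)
  qed (auto simp: D_def)
  then obtain S where S: "S \<in> D" "\<And>S'. S' \<in> D \<Longrightarrow> S \<preceq> S' \<Longrightarrow> S' = S" by blast
  have SM: "S \<in> M" "positive_op S" "S \<preceq> R" "inner (app S x) x \<le> Re (\<tau> S)"
    using S(1) by (auto simp: D_def)
  define Q where "Q = R - S"
  have QM: "Q \<in> M" and Qpos: "positive_op Q" and QR: "Q \<preceq> R"
    using SM R by (auto simp: Q_def op_le_def)
  have Q0: "Q \<noteq> 0" using SM(4) x by (auto simp: Q_def)
  \<comment> \<open>A T violating this could be added to S without leaving \<open>D\<close>, against
    maximality.\<close>
  have below: "Re (\<tau> T) \<le> inner (app T x) x" if T: "T \<in> M" "positive_op T" "T \<preceq> Q" for T
  proof (rule ccontr)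
    assume c: "\<not> ?thesis"
    have "S + T \<preceq> S + Q" by (rule op_le_add_mono[OF T(3)])
    then have "S + T \<in> D"
      using c SM T by (auto simp: D_def Q_def tr_add positive_op_add inner_add_left)
    moreover have "S \<preceq> S + T" using T(2) by (simp add: op_le_def)
    ultimately have "S + T = S" using S(2) by blast
    then have "T = 0" by simp
    with c show False by simp
  qed
  obtain L where L: "L > 0" "\<And>y. norm (app Q y) \<le> L * norm y" using app_bound by blast
  have dom: "tnorm (T * Q) \<le> norm (app T (app Q x))" if T: "T \<in> M" for T
  proof -
    obtain K where K: "K > 0" "\<And>y. norm (app T y) \<le> K * norm y" using app_bound by blast
    define X where "X = adj (T * Q) * (T * Q)"
    have XM: "X \<in> M" using T QM unfolding X_def by (intro M_closed M_adj)
    have Xpos: "positive_op X" unfolding X_def by (rule positive_op_square)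
    have Xin: "inner (app X y) y = (norm (app T (app Q y)))\<^sup>2" for y
      unfolding X_def app_bop_simps inner_adj' by (simp add: power2_norm_eq_inner)
    \<comment> \<open>The bound K of T and the bound L of Q give |T Q y|^2 \<le> K^2 L <Q y, y>, so
      this factor brings X below Q, where \<open>below\<close> applies. The dominating vector is
      therefore Q x and not x.\<close>
    define c where "c = 1 / (K\<^sup>2 * L)"
    have c: "c > 0" using K L by (simp add: c_def)
    have "c *\<^sub>R X \<preceq> Q"
      unfolding op_le_def
    proof (rule positive_opI)
      show "adj (Q - c *\<^sub>R X) = Q - c *\<^sub>R X" using positive_op_adj[OF Xpos] positive_op_adj[OF Qpos] by simp
      fix y
      have "(norm (app T (app Q y)))\<^sup>2 \<le> (K * norm (app Q y))\<^sup>2" by (intro power_mono K) simp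
      also have "\<dots> = K\<^sup>2 * (norm (app Q y))\<^sup>2" by (simp add: power_mult_distrib)
      also have "\<dots> \<le> K\<^sup>2 * (L * inner (app Q y) y)"
        by (intro mult_left_mono positive_norm_bound[OF Qpos op_le_refl L]) simp
      finally have "c * (norm (app T (app Q y)))\<^sup>2 \<le> inner (app Q y) y"
        using K L by (simp add: c_def field_simps)
      then show "0 \<le> inner (app (Q - c *\<^sub>R X) y) y" by (simp add: inner_diff_left Xin)
    qed
    from below[OF _ positive_op_scaleR[OF Xpos] this] c XM
    have "c * Re (\<tau> X) \<le> c * (norm (app T (app Q x)))\<^sup>2" by (simp add: tr_scaleR Xin)
    then have "Re (\<tau> X) \<le> (norm (app T (app Q x)))\<^sup>2" using c by simp
    then show ?thesis unfolding tnorm_def ip_def X_def by (intro real_le_lsqrt) simp_all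
  qed
  have "dominated Q" unfolding dominated_def using QM dom by blast
  with Q0 Qpos QR show ?thesis by blast
qed

text \<open>A maximal P \<le> 1 in G must be 1: otherwise a nonzero dominated Q fits below 1 - P and
  P + Q is larger. G stays abstract because it will be the zero set of a bounded additive
  form.\<close>

lemma one_in_dominated_closure:
  assumes dom: "\<And>Q. dominated Q \<Longrightarrow> Q \<in> G"
    and add: "\<And>P Q. P \<in> G \<Longrightarrow> Q \<in> G \<Longrightarrow> P + Q \<in> G"
    and cl: "\<And>T. T \<in> M \<Longrightarrow> (\<And>e. e > 0 \<Longrightarrow> \<exists>S\<in>G. S \<in> M \<and> tnorm (T - S) < e) \<Longrightarrow> T \<in> G"
  shows "1 \<in> G"
proof -
  define D where "D = {P \<in> M. positive_op P \<and> P \<preceq> 1 \<and> P \<in> G}"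
  have "\<exists>P\<in>D. \<forall>S\<in>D. P \<preceq> S \<longrightarrow> S = P"
  proof (rule maximal_element_exists[of 1])
    have "positive_op 1" by (rule positive_opI) simp_all
    then show "D \<noteq> {}"
      using dom[OF dominated_0] by (auto simp: D_def op_le_0 intro!: exI[of _ 0])
    fix S T assume S: "\<And>n. S n \<in> D" "\<And>n. S n \<preceq> S (Suc n)" "\<And>x. (\<lambda>n. app (S n) x) \<longlonglongrightarrow> app T x"
    have SM: "S n \<in> M" "positive_op (S n)" "S n \<preceq> 1" "S n \<in> G" for n using S(1) by (auto simp: D_def)
    have TM: "T \<in> M" by (rule M_limit[OF S(3) SM(1)])
    have T1: "T \<preceq> 1" by (rule limit_op_le[OF S(3) SM(3)])
    \<comment> \<open>For 0 \<le> X \<le> 1 one has X^2 \<le> X; this turns convergence of traces,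
      which normality provides, into convergence in \<open>tnorm\<close>.\<close>
    have le: "(tnorm (T - S n))\<^sup>2 \<le> Re (\<tau> T) - Re (\<tau> (S n))" for n
    proof -
      let ?X = "T - S n"
      have X: "positive_op ?X" using increasing_limit_upper[OF S(2,3)] by (simp add: op_le_def)
      have "?X \<preceq> T" using SM(2)[of n] by (simp add: op_le_def)
      then have X1: "?X \<preceq> 1" using T1 op_le_trans by blast
      have XM: "?X \<in> M" using TM SM(1) by simp
      have "adj ?X * ?X \<preceq> ?X"
        unfolding op_le_def
      proof (rule positive_opI)
        show "adj (?X - adj ?X * ?X) = ?X - adj ?X * ?X" using positive_op_adj[OF X] by simp
        show "0 \<le> inner (app (?X - adj ?X * ?X) y) y" for y
          using positive_norm_bound[OF X X1, of 1 y]
          unfolding app_bop_simps(5)[of ?X] app_bop_simps(7) inner_diff_left inner_adj'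
          by (simp add: power2_norm_eq_inner)
      qed
      then have "Re (\<tau> (adj ?X * ?X)) \<le> Re (\<tau> ?X)" 
        by (intro tr_mono M_closed(3) M_adj XM)
      moreover have "Re (\<tau> (adj ?X * ?X)) = (tnorm ?X)\<^sup>2"
        using ip_self[OF XM] by (simp add: ip_def del: of_real_power adj_simps)
      ultimately show ?thesis using TM SM(1) by (simp add: tr_diff)
    qed
    have "T \<in> G"
    proof (rule cl[OF TM])
      fix e :: real assume e: "e > 0"
      have "(\<lambda>n. Re (\<tau> T) - Re (\<tau> (S n))) \<longlonglongrightarrow> Re (\<tau> T) - Re (\<tau> T)"
        by (intro tendsto_intros tr_limit[OF SM(1,2) S(2,3)])
      then have "eventually (\<lambda>n. Re (\<tau> T) - Re (\<tau> (S n)) < e\<^sup>2) sequentially"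
        by (rule order_tendstoD) (use e in simp)
      then obtain n where "Re (\<tau> T) - Re (\<tau> (S n)) < e\<^sup>2" by (auto simp: eventually_sequentially)
      then have "(tnorm (T - S n))\<^sup>2 < e\<^sup>2" using le[of n] by linarith
      then have "tnorm (T - S n) < e" by (rule power_less_imp_less_base) (use e in simp)
      then show "\<exists>S\<in>G. S \<in> M \<and> tnorm (T - S) < e" using SM by blast
    qed
    then show "T \<in> D" using TM T1 positive_op_limit[OF S(3) SM(2)] by (simp add: D_def)
  qed (auto simp: D_def)
  then obtain P where P: "P \<in> M" "positive_op P" "P \<preceq> 1" "P \<in> G"
    and max: "\<And>S. S \<in> D \<Longrightarrow> P \<preceq> S \<Longrightarrow> S = P" by (auto simp: D_def)
  have "1 - P = 0"
  proof (rule ccontr)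
    assume "1 - P \<noteq> 0"
    then obtain Q where Q: "dominated Q" "Q \<noteq> 0" "positive_op Q" "Q \<preceq> 1 - P"
      using dominated_below_exists[of "1 - P"] P by (auto simp: op_le_def)
    have "P + Q \<preceq> P + (1 - P)" by (rule op_le_add_mono[OF Q(4)])
    moreover have "Q \<in> M" using Q(1) by (simp add: dominated_def)
    ultimately have "P + Q \<in> D"
      using P Q dom add by (simp add: D_def positive_op_add)
    moreover have "P \<preceq> P + Q" using Q(3) by (simp add: op_le_def)
    ultimately have "P + Q = P" by (rule max)
    then show False using Q(2) by simp
  qed
  then have "P = 1" by (metis eq_iff_diff_eq_0)
  with P show ?thesis by simp
qed

end

section \<open>The trace projection onto a selfadjoint subalgebra\<close>

lemma cmod_zeroI:
  assumes "C \<ge> 0" "\<And>e. e > 0 \<Longrightarrow> cmod z \<le> C * e"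
  shows "z = 0"
proof (rule ccontr)
  assume "z \<noteq> 0"
  then have z: "cmod z > 0" by simp
  have "cmod z \<le> C * (cmod z / (2 * (C + 1)))" using z assms(1) by (intro assms(2)) simp
  also have "\<dots> = cmod z * (C / (2 * (C + 1)))" by simp
  also have "\<dots> < cmod z * 1" using assms(1) by (intro mult_strict_left_mono z) simp
  finally show False by simp
qed

locale tracial_vn_subalgebra = tracial_vn M \<tau>
  for M :: "'h::complex_hilbert bop set" and \<tau> :: "'h bop \<Rightarrow> complex" +
  fixes A :: "'h bop set"
  assumes A_alg: "unital_subalgebra A" and A_sub: "A \<subseteq> M" and A_adj: "T \<in> A \<Longrightarrow> adj T \<in> A"
begin

lemmas A_closed = unital_subalgebraD[OF A_alg]

lemma A_M [simp]: "T \<in> A \<Longrightarrow> T \<in> M"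
  using A_sub by blast

text \<open>In the L2 completion this says that q in A is within \<eta> of the projection of Q onto
  the closure of A, a projection that need not lie in A or even in M.\<close>

definition approx :: "real \<Rightarrow> 'h bop \<Rightarrow> 'h bop \<Rightarrow> bool" where
  "approx \<eta> Q q \<longleftrightarrow> q \<in> A \<and> (\<forall>b\<in>A. cmod (ip (Q - q) b) \<le> \<eta> * tnorm b)"

text \<open>A q whose squared distance to Q is within \<open>\<eta>\<^sup>2\<close> of the infimum
  works: a b violating the estimate would give a correction of q that lowers the squared distance by
  more than this margin.\<close>

lemma approx_exists:
  assumes \<eta>: "\<eta> > 0" and Q: "Q \<in> M"
  shows "\<exists>q. approx \<eta> Q q"
proof -
  define d where "d = (INF a\<in>A. (tnorm (Q - a))\<^sup>2)"
  have bdd: "bdd_below ((\<lambda>a. (tnorm (Q - a))\<^sup>2) ` A)" by (rule bdd_belowI2[of _ 0]) simp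
  have "d < d + \<eta>\<^sup>2" using \<eta> by simp
  then obtain q where q: "q \<in> A" "(tnorm (Q - q))\<^sup>2 < d + \<eta>\<^sup>2"
    using cINF_less_iff[OF _ bdd] A_closed(1) unfolding d_def by blast
  have "cmod (ip (Q - q) b) \<le> \<eta> * tnorm b" if b: "b \<in> A" for b
  proof (rule ccontr)
    let ?z = "ip (Q - q) b"
    assume "\<not> ?thesis"
    then have gt: "\<eta> * tnorm b < cmod ?z" by simp
    have bM: "b \<in> M" and qM: "q \<in> M" using b q(1) by auto
    have z0: "cmod ?z > 0" using gt \<eta> tnorm_nonneg[OF bM] by (smt (verit) mult_nonneg_nonneg)
    have tb: "tnorm b > 0"
    proof (rule ccontr)
      assume "\<not> tnorm b > 0"
      then have "tnorm b = 0" using tnorm_nonneg[OF bM] by simp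
      then show False using ip_cauchy_schwarz[of "Q - q" b] z0 Q qM bM by simp
    qed
    \<comment> \<open>The correction \<open>c *\<^sub>C b\<close> has \<open>tnorm\<close> exactly
      \<eta>, and the phase of c makes its product with the residual real and positive.\<close>
    define r where "r = \<eta> / tnorm b"
    define c where "c = of_real (r / cmod ?z) * ?z"
    have r: "r > 0" using \<eta> tb by (simp add: r_def)
    have "cnj c * ?z = of_real (r / cmod ?z) * (?z * cnj ?z)" by (simp add: c_def mult_ac)
    also have "\<dots> = of_real (r / cmod ?z * (cmod ?z)\<^sup>2)"
      by (metis complex_norm_square of_real_mult of_real_power)
    also have "r / cmod ?z * (cmod ?z)\<^sup>2 = r * cmod ?z" using z0 by (simp add: power2_eq_square)
    finally have cz: "Re (cnj c * ?z) = r * cmod ?z" by simp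
    have cc: "cmod c = r" 
      unfolding c_def norm_mult norm_of_real using z0 r by simp
    have "q + c *\<^sub>C b \<in> A" using q(1) b A_closed by blast
    then have "d \<le> (tnorm (Q - (q + c *\<^sub>C b)))\<^sup>2" unfolding d_def by (rule cINF_lower[OF bdd])
    also have "Q - (q + c *\<^sub>C b) = (Q - q) - c *\<^sub>C b" by simp
    also have "(tnorm ((Q - q) - c *\<^sub>C b))\<^sup>2 = (tnorm (Q - q))\<^sup>2 - 2 * (r * cmod ?z) + r\<^sup>2 * (tnorm b)\<^sup>2"
      using tnorm_diff_scale[of "Q - q" b c] Q qM bM cz cc by simp
    also have "r\<^sup>2 * (tnorm b)\<^sup>2 = \<eta>\<^sup>2" using tb by (simp add: r_def power_divide)
    finally have "r * cmod ?z < \<eta>\<^sup>2" using q(2) by linarith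
    moreover have "r * (\<eta> * tnorm b) < r * cmod ?z" using gt r by simp
    moreover have "r * (\<eta> * tnorm b) = \<eta>\<^sup>2" using tb by (simp add: r_def power2_eq_square)
    ultimately show False by linarith
  qed
  with q(1) show ?thesis by (auto simp: approx_def)
qed

lemma approxD: "approx \<eta> Q q \<Longrightarrow> q \<in> A" "approx \<eta> Q q \<Longrightarrow> q \<in> M"
  by (auto simp: approx_def)

lemma approx_le: "approx \<eta> Q q \<Longrightarrow> b \<in> A \<Longrightarrow> cmod (ip (Q - q) b) \<le> \<eta> * tnorm b"
  by (auto simp: approx_def)

lemma approx_le': "approx \<eta> Q q \<Longrightarrow> b \<in> A \<Longrightarrow> Q \<in> M \<Longrightarrow> cmod (ip b (Q - q)) \<le> \<eta> * tnorm b"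
  using approx_le[of \<eta> Q q b] ip_commute[of b "Q - q"] approxD by simp

lemma approx_add:
  assumes "approx \<eta> Q q" "approx \<eta>' Q' q'" "Q \<in> M" "Q' \<in> M"
  shows "approx (\<eta> + \<eta>') (Q + Q') (q + q')"
  unfolding approx_def
proof (intro conjI ballI)
  show "q + q' \<in> A" 
    by (rule A_closed(2)[OF approxD(1)[OF assms(1)] approxD(1)[OF assms(2)]])
  fix b assume b: "b \<in> A"
  have "ip (Q + Q' - (q + q')) b = ip (Q - q) b + ip (Q' - q') b"
    using assms b approxD by (simp add: ip_diff_left ip_add_left)
  then show "cmod (ip (Q + Q' - (q + q')) b) \<le> (\<eta> + \<eta>') * tnorm b"
    using approx_le[OF assms(1) b] approx_le[OF assms(2) b] norm_triangle_ineq
    by (smt (verit) distrib_right)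
qed

lemma approx_bound:
  assumes q: "approx \<eta> Q q" and Q: "Q \<in> M" and \<eta>: "0 \<le> \<eta>"
  shows "tnorm q \<le> tnorm Q + \<eta>"
proof -
  have qM: "q \<in> M" "q \<in> A" using q approxD by auto
  have "complex_of_real ((tnorm q)\<^sup>2) = ip Q q - ip (Q - q) q"
    using qM Q by (simp add: ip_diff_left ip_self[symmetric] del: of_real_power)
  then have "(tnorm q)\<^sup>2 = cmod (ip Q q - ip (Q - q) q)" by (metis abs_power2 norm_of_real)
  also have "\<dots> \<le> cmod (ip Q q) + cmod (ip (Q - q) q)" by (rule norm_triangle_ineq4)
  also have "\<dots> \<le> tnorm Q * tnorm q + \<eta> * tnorm q"
    by (intro add_mono ip_cauchy_schwarz approx_le[OF q] qM Q)
  finally have "tnorm q * tnorm q \<le> (tnorm Q + \<eta>) * tnorm q"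
    by (simp add: power2_eq_square distrib_right)
  then show ?thesis
    using tnorm_nonneg[OF qM(1)] tnorm_nonneg[OF Q] \<eta> by (cases "tnorm q = 0") auto
qed

text \<open>Both conditions are tested on q - q', which lies in A. Hence approximants with shrinking
  tolerances are Cauchy.\<close>

lemma approx_close:
  assumes q: "approx \<eta> Q q" and q': "approx \<eta>' Q q'" and Q: "Q \<in> M" and \<eta>: "0 \<le> \<eta>" "0 \<le> \<eta>'"
  shows "tnorm (q - q') \<le> \<eta> + \<eta>'"
proof -
  let ?d = "q - q'"
  have dM: "?d \<in> A" "?d \<in> M" "q \<in> M" "q' \<in> M" using q q' approxD A_closed by auto
  have "complex_of_real ((tnorm ?d)\<^sup>2) = ip (Q - q') ?d - ip (Q - q) ?d"
    using dM Q by (simp add: ip_diff_left ip_self[symmetric] del: of_real_power)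
  then have "(tnorm ?d)\<^sup>2 = cmod (ip (Q - q') ?d - ip (Q - q) ?d)" by (metis abs_power2 norm_of_real)
  also have "\<dots> \<le> cmod (ip (Q - q') ?d) + cmod (ip (Q - q) ?d)" by (rule norm_triangle_ineq4)
  also have "\<dots> \<le> \<eta>' * tnorm ?d + \<eta> * tnorm ?d"
    by (intro add_mono approx_le[OF q'] approx_le[OF q] dM)
  finally have "tnorm ?d * tnorm ?d \<le> (\<eta> + \<eta>') * tnorm ?d"
    by (simp add: power2_eq_square distrib_right)
  then show ?thesis
    using tnorm_nonneg[OF dM(2)] \<eta> by (cases "tnorm ?d = 0") auto
qed

section \<open>The projection onto the closure of A, as a form on M\<close>

definition apx :: "nat \<Rightarrow> 'h bop \<Rightarrow> 'h bop" where
  "apx n Q = (SOME q. approx (1 / real (Suc n)) Q q)"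

lemma apx: "Q \<in> M \<Longrightarrow> approx (1 / real (Suc n)) Q (apx n Q)"
  unfolding apx_def by (rule someI_ex[OF approx_exists]) simp_all

text \<open>\<open>proj_ip Q R\<close> stands for \<open>\<langle>p Q, R\<rangle>\<close>, where \<open>p\<close> is the orthogonal projection of \<open>L\<^sup>2(M, \<tau>)\<close> onto
  the closure of \<open>A\<close>; the completion itself is never formed.\<close>

definition proj_ip :: "'h bop \<Rightarrow> 'h bop \<Rightarrow> complex" where
  "proj_ip Q R = lim (\<lambda>n. ip (apx n Q) R)"

lemma proj_ip_tendsto:
  assumes Q: "Q \<in> M" and R: "R \<in> M"
  shows "(\<lambda>n. ip (apx n Q) R) \<longlonglongrightarrow> proj_ip Q R"
proof -
  have aM: "apx n Q \<in> M" for n using apx[OF Q] approxD by blast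
  have "Cauchy (\<lambda>n. ip (apx n Q) R)"
  proof (rule metric_CauchyI)
    fix e :: real assume e: "0 < e"
    obtain N where N: "2 * (tnorm R + 1) / e < real (Suc N)"
      using reals_Archimedean2[of "2 * (tnorm R + 1) / e"] by (meson lessI of_nat_less_iff order_less_trans)
    show "\<exists>M. \<forall>m\<ge>M. \<forall>n\<ge>M. dist (ip (apx m Q) R) (ip (apx n Q) R) < e"
    proof (intro exI allI impI)
      fix m n assume mn: "N \<le> m" "N \<le> n"
      have "1 / real (Suc m) \<le> 1 / real (Suc N)" "1 / real (Suc n) \<le> 1 / real (Suc N)"
        using mn by (auto intro!: divide_left_mono)
      then have "tnorm (apx m Q - apx n Q) \<le> 2 / real (Suc N)"
        using approx_close[OF apx[OF Q] apx[OF Q] Q, of m n] by simp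
      then have "tnorm (apx m Q - apx n Q) * tnorm R \<le> 2 / real (Suc N) * tnorm R"
        using tnorm_nonneg[OF R] by (rule mult_right_mono)
      also have "\<dots> < e" using N e by (simp add: field_simps)
      finally show "dist (ip (apx m Q) R) (ip (apx n Q) R) < e"
        using ip_cauchy_schwarz[of "apx m Q - apx n Q" R] aM R by (simp add: dist_norm ip_diff_left)
    qed
  qed
  then show ?thesis
    unfolding proj_ip_def by (simp add: Cauchy_convergent convergent_LIMSEQ_iff[symmetric])
qed

text \<open>Makes the form independent of the choice in \<open>apx\<close>, so that it can be
  computed from sums of approximants or from an exact projection.\<close>

lemma proj_ip_unique:
  assumes Q: "Q \<in> M" and R: "R \<in> M" and q: "\<And>n. approx (\<eta> n) Q (q n)" and \<eta>: "\<eta> \<longlonglongrightarrow> 0" "\<And>n. 0 \<le> \<eta> n"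
  shows "(\<lambda>n. ip (q n) R) \<longlonglongrightarrow> proj_ip Q R"
proof -
  have qM: "q n \<in> M" "apx n Q \<in> M" for n using q apx[OF Q] approxD by blast+
  have "(\<lambda>n. ip (q n) R - ip (apx n Q) R) \<longlonglongrightarrow> 0"
  proof (rule Lim_null_comparison)
    show "eventually (\<lambda>n. norm (ip (q n) R - ip (apx n Q) R) \<le> (\<eta> n + 1 / real (Suc n)) * tnorm R) sequentially"
    proof (intro always_eventually allI)
      fix n
      have "norm (ip (q n) R - ip (apx n Q) R) \<le> tnorm (q n - apx n Q) * tnorm R"
        using ip_cauchy_schwarz[of "q n - apx n Q" R] qM R by (simp add: ip_diff_left)
      also have "\<dots> \<le> (\<eta> n + 1 / real (Suc n)) * tnorm R"
        using R by (intro mult_right_mono approx_close[OF q apx[OF Q] Q] \<eta>(2)) auto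
      finally show "norm (ip (q n) R - ip (apx n Q) R) \<le> (\<eta> n + 1 / real (Suc n)) * tnorm R" .
    qed
    have "(\<lambda>n. (\<eta> n + 1 / real (Suc n)) * tnorm R) \<longlonglongrightarrow> (0 + 0) * tnorm R"
      by (intro tendsto_intros \<eta> LIMSEQ_Suc[OF lim_1_over_n])
    then show "(\<lambda>n. (\<eta> n + 1 / real (Suc n)) * tnorm R) \<longlonglongrightarrow> 0" by simp
  qed
  from tendsto_add[OF this proj_ip_tendsto[OF Q R]] show ?thesis by simp
qed

lemma proj_ip_add_left:
  assumes "P \<in> M" "Q \<in> M" "R \<in> M"
  shows "proj_ip (P + Q) R = proj_ip P R + proj_ip Q R"
proof -
  have aM: "apx n P \<in> M" "apx n Q \<in> M" for n using apx assms approxD by blast+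
  have "(\<lambda>n. 1 / real (Suc n) + 1 / real (Suc n)) \<longlonglongrightarrow> 0 + 0"
    by (intro tendsto_intros LIMSEQ_Suc[OF lim_1_over_n])
  then have "(\<lambda>n. ip (apx n P + apx n Q) R) \<longlonglongrightarrow> proj_ip (P + Q) R"
    using assms by (intro proj_ip_unique[OF _ _ approx_add[OF apx apx]]) auto
  moreover have "(\<lambda>n. ip (apx n P + apx n Q) R) \<longlonglongrightarrow> proj_ip P R + proj_ip Q R"
    using tendsto_add[OF proj_ip_tendsto[of P R] proj_ip_tendsto[of Q R]] assms aM
    by (simp add: ip_add_left)
  ultimately show ?thesis by (rule LIMSEQ_unique)
qed

lemma proj_ip_add_right:
  assumes "P \<in> M" "Q \<in> M" "R \<in> M"
  shows "proj_ip R (P + Q) = proj_ip R P + proj_ip R Q"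
proof -
  have aM: "apx n R \<in> M" for n using apx assms approxD by blast
  have "(\<lambda>n. ip (apx n R) (P + Q)) \<longlonglongrightarrow> proj_ip R P + proj_ip R Q"
    using tendsto_add[OF proj_ip_tendsto[of R P] proj_ip_tendsto[of R Q]] assms aM
    by (simp add: ip_add_right)
  with proj_ip_tendsto[of R "P + Q"] assms show ?thesis using LIMSEQ_unique by blast
qed

lemma proj_ip_bound:
  assumes Q: "Q \<in> M" and R: "R \<in> M"
  shows "cmod (proj_ip Q R) \<le> tnorm Q * tnorm R"
proof (rule LIMSEQ_le)
  show "(\<lambda>n. cmod (ip (apx n Q) R)) \<longlonglongrightarrow> cmod (proj_ip Q R)"
    by (intro tendsto_intros proj_ip_tendsto Q R)
  have "(\<lambda>n. (tnorm Q + 1 / real (Suc n)) * tnorm R) \<longlonglongrightarrow> (tnorm Q + 0) * tnorm R"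
    by (intro tendsto_intros LIMSEQ_Suc[OF lim_1_over_n])
  then show "(\<lambda>n. (tnorm Q + 1 / real (Suc n)) * tnorm R) \<longlonglongrightarrow> tnorm Q * tnorm R" by simp
  have "cmod (ip (apx n Q) R) \<le> (tnorm Q + 1 / real (Suc n)) * tnorm R" for n
  proof -
    have "cmod (ip (apx n Q) R) \<le> tnorm (apx n Q) * tnorm R"
      by (intro ip_cauchy_schwarz R approxD(2)[OF apx[OF Q]])
    also have "\<dots> \<le> (tnorm Q + 1 / real (Suc n)) * tnorm R"
      using R by (intro mult_right_mono approx_bound[OF apx[OF Q] Q]) auto
    finally show ?thesis .
  qed
  then show "\<exists>N. \<forall>n\<ge>N. cmod (ip (apx n Q) R) \<le> (tnorm Q + 1 / real (Suc n)) * tnorm R" by blast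
qed

lemma proj_ip_of_approx:
  assumes "approx 0 Q q" "Q \<in> M" "R \<in> M"
  shows "proj_ip Q R = ip q R"
  using proj_ip_unique[of Q R "\<lambda>_. 0" "\<lambda>_. q"] assms by (simp add: LIMSEQ_const_iff)

text \<open>Left multiplication by a and by adj a preserves A, so it commutes with the projection:
  for approximants q of Q and q' of Q', both sides are approximated by
  \<open>ip (a * q n) (q' n)\<close>.\<close>

lemma proj_ip_mult:
  assumes a: "a \<in> A" and Q: "Q \<in> M" and Q': "Q' \<in> M"
  shows "cnj (proj_ip Q' (a * Q)) = proj_ip Q (adj a * Q')"
proof -
  define q where "q n = apx n Q" for n
  define q' where "q' n = apx n Q'" for n
  have apq: "approx (1 / real (Suc n)) Q (q n)" "approx (1 / real (Suc n)) Q' (q' n)" for n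
    using apx Q Q' by (simp_all add: q_def q'_def)
  have qA: "q n \<in> A" "q' n \<in> A" "q n \<in> M" "q' n \<in> M" for n using apq[of n] approxD by blast+
  have aM: "a \<in> M" using a by simp
  obtain K where K: "K > 0" "\<And>x. norm (app a x) \<le> K * norm x" using app_bound by blast
  have bound: "tnorm (b * r) \<le> K * (tnorm R + 1)"
    if "b = a \<or> b = adj a" "approx (1 / real (Suc n)) R r" "R \<in> M" for b R r n
  proof -
    have "tnorm (b * r) \<le> K * tnorm r"
      using that aM approxD K app_adj_bound[OF K] by (auto intro!: tnorm_mult_left)
    moreover have "tnorm r \<le> tnorm R + 1 / real (Suc n)" using approx_bound that by auto
    moreover have "1 / real (Suc n) \<le> 1" by simp
    ultimately show ?thesis using K(1) by (smt (verit) mult_left_mono)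
  qed
  have small: "(\<lambda>n. 1 / real (Suc n) * C) \<longlonglongrightarrow> 0" for C
    by (rule tendsto_mult_left_zero[OF LIMSEQ_Suc[OF lim_1_over_n]])
  \<comment> \<open>a q stays in A and bounded in \<open>tnorm\<close>, while Q' - q' is
    asymptotically orthogonal to A.\<close>
  have 1: "(\<lambda>n. ip (a * q n) (Q' - q' n)) \<longlonglongrightarrow> 0"
  proof (rule Lim_null_comparison[OF _ small])
    show "eventually (\<lambda>n. norm (ip (a * q n) (Q' - q' n)) \<le> 1 / real (Suc n) * (K * (tnorm Q + 1))) sequentially"
    proof (intro always_eventually allI)
      fix n
      have "norm (ip (a * q n) (Q' - q' n)) \<le> 1 / real (Suc n) * tnorm (a * q n)"
        using approx_le'[OF apq(2)] A_closed(3)[OF a qA(1)] Q' by blast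
      also have "\<dots> \<le> 1 / real (Suc n) * (K * (tnorm Q + 1))"
        by (intro mult_left_mono bound[OF _ apq(1) Q]) simp_all
      finally show "norm (ip (a * q n) (Q' - q' n)) \<le> 1 / real (Suc n) * (K * (tnorm Q + 1))" .
    qed
  qed
  have 2: "(\<lambda>n. ip (Q - q n) (adj a * q' n)) \<longlonglongrightarrow> 0"
  proof (rule Lim_null_comparison[OF _ small])
    show "eventually (\<lambda>n. norm (ip (Q - q n) (adj a * q' n)) \<le> 1 / real (Suc n) * (K * (tnorm Q' + 1))) sequentially"
    proof (intro always_eventually allI)
      fix n
      have "norm (ip (Q - q n) (adj a * q' n)) \<le> 1 / real (Suc n) * tnorm (adj a * q' n)"
        using approx_le[OF apq(1)] A_closed(3)[OF A_adj[OF a] qA(2)] by blast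
      also have "\<dots> \<le> 1 / real (Suc n) * (K * (tnorm Q' + 1))"
        by (intro mult_left_mono bound[OF _ apq(2) Q']) simp_all
      finally show "norm (ip (Q - q n) (adj a * q' n)) \<le> 1 / real (Suc n) * (K * (tnorm Q' + 1))" .
    qed
  qed
  have "ip (a * q n) (Q' - q' n) - ip (Q - q n) (adj a * q' n) = ip (q n) (adj a * Q') - cnj (ip (q' n) (a * Q))" for n
  proof -
    have "ip (Q - q n) (adj a * q' n) = ip (a * Q) (q' n) - ip (a * q n) (q' n)"
      using Q aM qA by (simp add: ip_diff_left ip_mult_left)
    moreover have "ip (a * Q) (q' n) = cnj (ip (q' n) (a * Q))" using Q aM qA by (intro ip_commute) auto
    ultimately show ?thesis using Q' aM qA by (simp add: ip_diff_right ip_mult_left[of a "q n" Q'])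
  qed
  then have "(\<lambda>n. ip (q n) (adj a * Q') - cnj (ip (q' n) (a * Q))) \<longlonglongrightarrow> 0 - 0"
    using tendsto_diff[OF 1 2] by simp
  moreover have "(\<lambda>n. ip (q n) (adj a * Q') - cnj (ip (q' n) (a * Q)))
      \<longlonglongrightarrow> proj_ip Q (adj a * Q') - cnj (proj_ip Q' (a * Q))"
    unfolding q_def q'_def using Q Q' aM by (intro tendsto_diff tendsto_cnj proj_ip_tendsto) auto
  ultimately have "proj_ip Q (adj a * Q') - cnj (proj_ip Q' (a * Q)) = 0 - 0"
    using LIMSEQ_unique by blast
  then show ?thesis by simp
qed

text \<open>The commutator \<open>[S, p]\<close> as a form; it vanishes for \<open>S\<close> in the bicommutant of \<open>A\<close>, because \<open>p\<close>
  commutes with the left multiplications by \<open>A\<close>.\<close>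

definition defect :: "'h bop \<Rightarrow> 'h bop \<Rightarrow> 'h bop \<Rightarrow> complex" where
  "defect S Q Q' = cnj (proj_ip Q' (S * Q)) - proj_ip Q (adj S * Q')"

lemma defect_add:
  assumes "S \<in> M" "P \<in> M" "Q \<in> M" "Q' \<in> M"
  shows "defect S (P + Q) Q' = defect S P Q' + defect S Q Q'"
    and "defect S Q' (P + Q) = defect S Q' P + defect S Q' Q"
  using assms by (simp_all add: defect_def distrib_left proj_ip_add_left proj_ip_add_right)

lemma defect_bound:
  assumes S: "S \<in> M"
  obtains K where "K > 0" "\<And>Q Q'. Q \<in> M \<Longrightarrow> Q' \<in> M \<Longrightarrow> cmod (defect S Q Q') \<le> K * (tnorm Q * tnorm Q')"
proof -
  obtain K where K: "K > 0" "\<And>x. norm (app S x) \<le> K * norm x" using app_bound by blast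
  have "cmod (defect S Q Q') \<le> 2 * K * (tnorm Q * tnorm Q')" if Q: "Q \<in> M" "Q' \<in> M" for Q Q'
  proof -
    have "cmod (defect S Q Q') \<le> cmod (proj_ip Q' (S * Q)) + cmod (proj_ip Q (adj S * Q'))"
      unfolding defect_def using norm_triangle_ineq4 complex_mod_cnj by metis
    also have "\<dots> \<le> tnorm Q' * tnorm (S * Q) + tnorm Q * tnorm (adj S * Q')"
      using S Q by (intro add_mono proj_ip_bound) auto
    also have "\<dots> \<le> tnorm Q' * (K * tnorm Q) + tnorm Q * (K * tnorm Q')"
      using S Q K app_adj_bound[OF K] by (intro add_mono mult_left_mono tnorm_mult_left) auto
    finally show ?thesis by (simp add: algebra_simps)
  qed
  with K(1) show thesis by (intro that[of "2 * K"]) simp_all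
qed

text \<open>The defect of T in A is 0 by \<open>proj_ip_mult\<close>, so only U = S - T contributes.
  The form involves both U * Q and adj U * Q', hence the need for one T that approximates S at x and
  whose adjoint approximates adj S at y.\<close>

lemma defect_dominated:
  assumes S: "S \<in> M" "S \<in> commutant (commutant A)" and Q: "dominated Q" and Q': "dominated Q'"
  shows "defect S Q Q' = 0"
proof -
  obtain x where x: "Q \<in> M" "\<And>T. T \<in> M \<Longrightarrow> tnorm (T * Q) \<le> norm (app T x)"
    using Q by (auto simp: dominated_def)
  obtain y where y: "Q' \<in> M" "\<And>T. T \<in> M \<Longrightarrow> tnorm (T * Q') \<le> norm (app T y)"
    using Q' by (auto simp: dominated_def)
  show ?thesis
  proof (rule cmod_zeroI)
    show "0 \<le> tnorm Q + tnorm Q'" using x(1) y(1) by simp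
    fix e :: real assume "e > 0"
    then obtain T where T: "T \<in> A" "norm (app (S - T) x) < e" "norm (app (adj (S - T)) y) < e"
      using bicommutant_strong_star[OF A_alg A_adj S(2)] by blast
    have TM: "T \<in> M" using T(1) by simp
    define U where "U = S - T"
    have UM: "U \<in> M" and SU: "S = U + T" using S TM by (simp_all add: U_def)
    have "defect S Q Q' = cnj (proj_ip Q' (U * Q)) - proj_ip Q (adj U * Q')
        + (cnj (proj_ip Q' (T * Q)) - proj_ip Q (adj T * Q'))"
      unfolding defect_def SU using x(1) y(1) UM TM by (simp add: distrib_right proj_ip_add_right)
    also have "\<dots> = cnj (proj_ip Q' (U * Q)) - proj_ip Q (adj U * Q')"
      using proj_ip_mult[OF T(1) x(1) y(1)] by simp
    finally have "cmod (defect S Q Q') \<le> cmod (proj_ip Q' (U * Q)) + cmod (proj_ip Q (adj U * Q'))"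
      by (metis norm_triangle_ineq4 complex_mod_cnj)
    also have "\<dots> \<le> tnorm Q' * tnorm (U * Q) + tnorm Q * tnorm (adj U * Q')"
      using UM x(1) y(1) by (intro add_mono proj_ip_bound) auto
    also have "\<dots> \<le> tnorm Q' * e + tnorm Q * e"
      using x(2)[OF UM] y(2)[OF M_adj[OF UM]] T(2,3) x(1) y(1) unfolding U_def[symmetric]
      by (intro add_mono mult_left_mono) auto
    finally show "cmod (defect S Q Q') \<le> (tnorm Q + tnorm Q') * e" by (simp add: algebra_simps)
  qed
qed

text \<open>Density is used twice: 1 is reached in the left argument with the right one still
  dominated, and then d, written as 1 * d, is reached in the right argument from Q * d with Q
  dominated.\<close>

lemma defect_bicommutant:
  assumes S: "S \<in> M" "S \<in> commutant (commutant A)" and d: "d \<in> M"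
  shows "defect S 1 d = 0"
proof -
  obtain K where K: "K > 0"
    "\<And>Q Q'. Q \<in> M \<Longrightarrow> Q' \<in> M \<Longrightarrow> cmod (defect S Q Q') \<le> K * (tnorm Q * tnorm Q')"
    using defect_bound[OF S(1)] by blast
  have one: "defect S 1 Q' = 0" if Q': "dominated Q'" for Q'
  proof -
    have Q'M: "Q' \<in> M" using Q' by (simp add: dominated_def)
    have "1 \<in> {Q \<in> M. defect S Q Q' = 0}"
    proof (rule one_in_dominated_closure)
      show "Q \<in> {Q \<in> M. defect S Q Q' = 0}" if "dominated Q" for Q
        using defect_dominated[OF S that Q'] that by (simp add: dominated_def)
      fix T assume T: "T \<in> M" and
        cl: "\<And>e. e > 0 \<Longrightarrow> \<exists>R\<in>{Q \<in> M. defect S Q Q' = 0}. R \<in> M \<and> tnorm (T - R) < e"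
      have "defect S T Q' = 0"
      proof (rule cmod_zeroI)
        show "0 \<le> K * tnorm Q'" using K Q'M by simp
        fix e :: real assume "e > 0"
        then obtain R where R: "R \<in> M" "defect S R Q' = 0" "tnorm (T - R) < e" using cl by blast
        have "defect S T Q' = defect S (T - R) Q' + defect S R Q'"
          using defect_add(1)[of S "T - R" R Q'] S T R Q'M by simp
        then have "cmod (defect S T Q') \<le> K * (tnorm (T - R) * tnorm Q')"
          using K(2)[of "T - R" Q'] T R Q'M by simp
        also have "\<dots> \<le> K * (e * tnorm Q')"
          using R K Q'M by (intro mult_left_mono mult_right_mono) auto
        finally show "cmod (defect S T Q') \<le> K * tnorm Q' * e" by (simp add: mult_ac)
      qed
      then show "T \<in> {Q \<in> M. defect S Q Q' = 0}" using T by simp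
    qed (use S Q'M in \<open>auto simp: defect_add\<close>)
    then show ?thesis by simp
  qed
  obtain L where L: "L > 0" "\<And>x. norm (app d x) \<le> L * norm x" using app_bound by blast
  have "1 \<in> {Q \<in> M. defect S 1 (Q * d) = 0}"
  proof (rule one_in_dominated_closure)
    show "Q \<in> {Q \<in> M. defect S 1 (Q * d) = 0}" if "dominated Q" for Q
      using one[OF dominated_mult_right[OF that d]] that by (simp add: dominated_def)
    fix T assume T: "T \<in> M" and
      cl: "\<And>e. e > 0 \<Longrightarrow> \<exists>R\<in>{Q \<in> M. defect S 1 (Q * d) = 0}. R \<in> M \<and> tnorm (T - R) < e"
    have "defect S 1 (T * d) = 0"
    proof (rule cmod_zeroI)
      show "0 \<le> K * tnorm 1 * L" using K L by simp
      fix e :: real assume "e > 0"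
      then obtain R where R: "R \<in> M" "defect S 1 (R * d) = 0" "tnorm (T - R) < e" using cl by blast
      have "T * d = (T - R) * d + R * d" by (simp add: left_diff_distrib)
      then have "defect S 1 (T * d) = defect S 1 ((T - R) * d) + defect S 1 (R * d)"
        using defect_add(2)[of S "(T - R) * d" "R * d" 1] S T R d by simp
      then have "cmod (defect S 1 (T * d)) \<le> K * (tnorm 1 * tnorm ((T - R) * d))"
        using K(2)[of 1 "(T - R) * d"] T R d by simp
      also have "\<dots> \<le> K * (tnorm 1 * (L * tnorm (T - R)))"
        using K T R d L by (intro mult_left_mono tnorm_mult_right) auto
      also have "\<dots> \<le> K * (tnorm 1 * (L * e))"
        using K T R L by (intro mult_left_mono) auto
      finally show "cmod (defect S 1 (T * d)) \<le> K * tnorm 1 * L * e" by (simp add: mult_ac)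
    qed
    then show "T \<in> {Q \<in> M. defect S 1 (Q * d) = 0}" using T by simp
  qed (use S d in \<open>auto simp: defect_add distrib_right\<close>)
  then show ?thesis by simp
qed

text \<open>An \<open>L\<^sup>2\<close> substitute for the Kaplansky density theorem.\<close>

theorem trace_orthogonal_bicommutant:
  assumes S: "S \<in> M" "S \<in> commutant (commutant A)" and d: "d \<in> M"
    and orth: "\<And>a. a \<in> A \<Longrightarrow> \<tau> (a * d) = 0"
  shows "\<tau> (S * d) = 0"
proof -
  have z: "ip (adj d) b = 0" if b: "b \<in> A" for b
  proof -
    have "ip (adj d) b = cnj (\<tau> (d * b))" using tr_adj[of "d * b"] b d by (simp add: ip_def)
    also have "\<tau> (d * b) = 0" using orth[OF b] tr_commute[of d b] b d by simp
    finally show ?thesis by simp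
  qed
  \<comment> \<open>With p the projection: adj d is orthogonal to A, so p (adj d) = 0, while p 1 =
    1. The vanishing defect equates <S, p (adj d)> with <p 1, adj S adj d>, which is
    \<open>\<tau> (d * S)\<close>.\<close>
  have "approx 0 (adj d) 0" using z A_closed by (simp add: approx_def)
  then have p: "proj_ip (adj d) (S * 1) = 0"
    using d S by (subst proj_ip_of_approx[of _ 0]) (auto simp: ip_def)
  have "approx 0 1 1" using A_closed by (simp add: approx_def ip_def)
  then have "proj_ip 1 (adj S * adj d) = ip 1 (adj S * adj d)"
    using d S by (intro proj_ip_of_approx) auto
  then have "ip 1 (adj S * adj d) = 0"
    using defect_bicommutant[OF S, of "adj d"] d p by (simp add: defect_def)
  then have "\<tau> (d * S) = 0" by (simp add: ip_def)
  then show ?thesis using tr_commute[of S d] S d by simp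
qed

end

section \<open>Generated algebras\<close>

lemma unital_subalgebra_alg_generated: "unital_subalgebra (alg_generated S)"
proof -
  have "unital_subalgebra (\<Inter>F)" if "\<forall>A\<in>F. unital_subalgebra A" for F :: "'a bop set set"
    using that unfolding unital_subalgebra_def by blast
  then show ?thesis unfolding alg_generated_def by (rule hull_in)
qed

lemma subset_alg_generated: "S \<subseteq> alg_generated S"
  unfolding alg_generated_def by (rule hull_subset)

lemma alg_generated_subset: "S \<subseteq> A \<Longrightarrow> unital_subalgebra A \<Longrightarrow> alg_generated S \<subseteq> A"
  unfolding alg_generated_def by (rule hull_minimal)

lemma adj_alg_generated:
  assumes S: "\<And>T. T \<in> S \<Longrightarrow> adj T = T" and T: "T \<in> alg_generated S"
  shows "adj T \<in> alg_generated S"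
proof -
  note c = unital_subalgebraD[OF unital_subalgebra_alg_generated[of S]]
  have "alg_generated S \<subseteq> {T \<in> alg_generated S. adj T \<in> alg_generated S}"
  proof (rule alg_generated_subset)
    show "S \<subseteq> {T \<in> alg_generated S. adj T \<in> alg_generated S}"
      using subset_alg_generated[of S] S by auto
    show "unital_subalgebra {T \<in> alg_generated S. adj T \<in> alg_generated S}"
      unfolding unital_subalgebra_def using c by auto
  qed
  with T show ?thesis by blast
qed

lemma commutant_antimono: "A \<subseteq> B \<Longrightarrow> commutant B \<subseteq> commutant A"
  by (auto simp: commutant_def)

lemma subset_bicommutant: "A \<subseteq> commutant (commutant A)"
  by (auto simp: commutant_def)

lemma adj_commutant:
  assumes "\<And>T. T \<in> A \<Longrightarrow> adj T \<in> A" "T \<in> commutant A"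
  shows "adj T \<in> commutant A"
  unfolding commutant_def
proof (safe)
  fix S assume "S \<in> A"
  then have "adj S * T = T * adj S" using assms by (auto simp: commutant_def)
  then have "adj (adj S * T) = adj (T * adj S)" by simp
  then show "S * adj T = adj T * S" by simp
qed

lemma von_neumann_algebra_bicommutant:
  assumes "\<And>T. T \<in> A \<Longrightarrow> adj T \<in> A"
  shows "von_neumann_algebra (commutant (commutant A))"
proof -
  have "commutant (commutant (commutant A)) = commutant A"
    using subset_bicommutant[of "commutant A"] commutant_antimono[OF subset_bicommutant[of A]] by blast
  then show ?thesis
    unfolding von_neumann_algebra_def using adj_commutant adj_commutant[OF assms] by metis
qed

lemma vn_generated_subset: "S \<subseteq> A \<Longrightarrow> von_neumann_algebra A \<Longrightarrow> vn_generated S \<subseteq> A"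
  unfolding vn_generated_def by (rule hull_minimal)

lemma subset_vn_generated: "S \<subseteq> vn_generated S"
  unfolding vn_generated_def by (rule hull_subset)

lemma von_neumann_algebra_vn_generated: "von_neumann_algebra (vn_generated S)"
proof -
  have "von_neumann_algebra (\<Inter>F)" if F: "\<forall>A\<in>F. von_neumann_algebra A" for F :: "'a bop set set"
  proof -
    have "commutant (commutant (\<Inter>F)) \<subseteq> A" if "A \<in> F" for A
      using commutant_antimono[OF commutant_antimono[OF Inter_lower[OF that]]] F that
      by (simp add: von_neumann_algebra_def)
    then have "commutant (commutant (\<Inter>F)) = \<Inter>F" using subset_bicommutant[of "\<Inter>F"] by blast
    then show ?thesis using F by (auto simp: von_neumann_algebra_def)
  qed
  then show ?thesis unfolding vn_generated_def by (rule hull_in)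
qed

text \<open>Hermitian generators make the polynomial algebra selfadjoint, so its bicommutant is a
  von Neumann algebra containing them.\<close>

lemma vn_generated_bicommutant:
  assumes "\<And>T. T \<in> S \<Longrightarrow> adj T = T"
  shows "vn_generated S \<subseteq> commutant (commutant (alg_generated S))"
  using subset_alg_generated[of S] subset_bicommutant[of "alg_generated S"]
    von_neumann_algebra_bicommutant[of "alg_generated S"] adj_alg_generated[of S] assms
  by (intro vn_generated_subset) blast+

lemma prod_list_in_unital_subalgebra:
  assumes "unital_subalgebra A" "set xs \<subseteq> A" shows "prod_list xs \<in> A"
  using assms(2) by (induction xs) (auto intro: unital_subalgebraD[OF assms(1)])

lemma sum_in_unital_subalgebra:
  assumes "unital_subalgebra A" "\<And>i. i \<in> I \<Longrightarrow> f i \<in> A" shows "sum f I \<in> A"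
  using assms(2) by (induction I rule: infinite_finite_induct)
    (auto intro: unital_subalgebraD[OF assms(1)])

section \<open>Products of pairs under the Leibniz rule\<close>

text \<open>A pair \<open>(a, a')\<close> is a letter with its derivative; \<open>leibniz\<close> is the derivative of the product of the
  letters.\<close>

fun leibniz :: "('h::complex_hilbert bop \<times> 'h bop) list \<Rightarrow> 'h bop" where
  "leibniz [] = 0"
| "leibniz (e # es) = snd e * prod_list (map fst es) + fst e * leibniz es"

lemma leibniz_append:
  "leibniz (us @ vs) = leibniz us * prod_list (map fst vs) + prod_list (map fst us) * leibniz vs"
  by (induction us) (simp_all add: algebra_simps)

text \<open>The product of dual numbers a + \<epsilon> a' with \<epsilon>^2 = 0.\<close>

definition dmul :: "'h::complex_hilbert bop \<times> 'h bop \<Rightarrow> 'h bop \<times> 'h bop \<Rightarrow> 'h bop \<times> 'h bop" where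
  "dmul e f = (fst e * fst f, snd e * fst f + fst e * snd f)"

lemma leibniz_dmul: "leibniz (us @ [e, f] @ vs) = leibniz (us @ [dmul e f] @ vs)"
  by (simp add: leibniz_append dmul_def algebra_simps)

lemma leibniz_add:
  "leibniz (us @ [(a + b, a' + b')] @ vs) = leibniz (us @ [(a, a')] @ vs) + leibniz (us @ [(b, b')] @ vs)"
  by (simp add: leibniz_append algebra_simps)

lemma leibniz_scalar: "leibniz (us @ [(c *\<^sub>C 1, 0)] @ vs) = c *\<^sub>C leibniz (us @ vs)"
  by (simp add: leibniz_append scaleC_mult_left scaleC_mult_right scaleC_add_right)

lemma leibniz_in_unital_subalgebra:
  assumes "unital_subalgebra A" "fst ` set es \<subseteq> A" "snd ` set es \<subseteq> A"
  shows "leibniz es \<in> A"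
  using assms(2,3)
proof (induction es)
  case (Cons e es)
  then have "prod_list (map fst es) \<in> A"
    by (intro prod_list_in_unital_subalgebra[OF assms(1)]) auto
  with Cons show ?case by (auto intro!: unital_subalgebraD[OF assms(1)])
qed (simp add: unital_subalgebraD[OF assms(1)])

lemma leibniz_word:
  "leibniz (map (\<lambda>j. (X j, x j)) w) =
    (\<Sum>k<length w. prod_list (map X (take k w)) * x (w ! k) * prod_list (map X (drop (Suc k) w)))"
proof (induction w)
  case (Cons j w)
  have "map fst (map (\<lambda>j. (X j, x j)) w) = map X w" by simp
  with Cons show ?case
    by (simp add: sum.lessThan_Suc_shift sum_distrib_left mult.assoc del: map_map sum.lessThan_Suc)
qed simp

text \<open>The polynomials in the letters with their derivatives. These are pairs and not a map,
  because relations among the letters may give one operator several derivatives.\<close>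

inductive_set word_span :: "('n \<Rightarrow> 'h::complex_hilbert bop \<times> 'h bop) \<Rightarrow> ('h bop \<times> 'h bop) set"
  for h where
  word: "(prod_list (map (fst \<circ> h) w), leibniz (map h w)) \<in> word_span h"
| add: "(a, a') \<in> word_span h \<Longrightarrow> (b, b') \<in> word_span h \<Longrightarrow> (a + b, a' + b') \<in> word_span h"
| scale: "(a, a') \<in> word_span h \<Longrightarrow> (c *\<^sub>C a, c *\<^sub>C a') \<in> word_span h"

lemma word_span_dmul:
  assumes "e \<in> word_span h" "f \<in> word_span h"
  shows "dmul e f \<in> word_span h"
proof -
  have 1: "(prod_list (map (fst \<circ> h) u) * b, leibniz (map h u) * b + prod_list (map (fst \<circ> h) u) * b')
      \<in> word_span h" if "(b, b') \<in> word_span h" for u b b'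
    using that
  proof induction
    case (word w)
    show ?case using word_span.word[of h "u @ w"] by (simp add: leibniz_append comp_def)
  next
    case (add a a' b b')
    from word_span.add[OF add.IH] show ?case by (simp add: algebra_simps)
  next
    case (scale a a' c)
    from word_span.scale[OF scale.IH, of c] show ?case
      by (simp add: scaleC_mult_right scaleC_add_right)
  qed
  have "(a * b, a' * b + a * b') \<in> word_span h"
    if "(a, a') \<in> word_span h" "(b, b') \<in> word_span h" for a a' b b'
    using that(1)
  proof induction
    case (word w)
    show ?case by (rule 1[OF that(2)])
  next
    case (add a a' c c')
    from word_span.add[OF add.IH] show ?case by (simp add: algebra_simps)
  next
    case (scale a a' c)
    from word_span.scale[OF scale.IH, of c] show ?case
      by (simp add: scaleC_mult_left scaleC_add_right)
  qed
  from this[of "fst e" "snd e" "fst f" "snd f"] assms show ?thesis by (simp add: dmul_def)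
qed

lemma word_span_generator: "h j \<in> word_span h"
  using word_span.word[of h "[j]"] by simp

lemma word_span_one: "(1, 0) \<in> word_span h"
  using word_span.word[of h "[]"] by simp

lemma word_span_diff_scalar: "(a, a') \<in> word_span h \<Longrightarrow> (a - c *\<^sub>C 1, a') \<in> word_span h"
  using word_span.add[OF _ word_span.scale[OF word_span_one, of "- c"], of a a' h]
  by (simp add: scaleC_minus_left scaleC_zero_right)

lemma word_span_fst_in:
  assumes "unital_subalgebra A" "\<And>j. fst (h j) \<in> A" "(a, a') \<in> word_span h"
  shows "a \<in> A"
  using assms(3)
proof induction
  case (word w)
  show ?case by (rule prod_list_in_unital_subalgebra[OF assms(1)]) (use assms(2) in auto)
qed (auto intro: unital_subalgebraD[OF assms(1)])

lemma word_span_snd_in: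
  assumes "unital_subalgebra A" "\<And>j. fst (h j) \<in> A" "\<And>j. snd (h j) \<in> A" "(a, a') \<in> word_span h"
  shows "a' \<in> A"
  using assms(4)
proof induction
  case (word w)
  show ?case by (rule leibniz_in_unital_subalgebra[OF assms(1)]) (use assms(2,3) in auto)
qed (auto intro: unital_subalgebraD[OF assms(1)])

lemma not_distinct_adj_map_split:
  "\<not> distinct_adj (map f es) \<Longrightarrow> \<exists>us p q vs. es = us @ [p, q] @ vs \<and> f p = f q"
proof (induction es)
  case (Cons e es)
  show ?case
  proof (cases es)
    case Nil
    with Cons.prems show ?thesis by simp
  next
    case (Cons e' es')
    show ?thesis
    proof (cases "f e = f e'")
      case True
      then show ?thesis using Cons by (intro exI[of _ "[]"]) auto
    next
      case False
      then have "\<not> distinct_adj (map f es)" using Cons Cons.prems by simp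
      from Cons.IH[OF this] obtain us p q vs where "es = us @ [p, q] @ vs" "f p = f q" by blast
      then show ?thesis by (intro exI[of _ "e # us"]) auto
    qed
  qed
qed simp

section \<open>Vanishing of the trace on derivatives of mixed products\<close>

text \<open>The letters are \<open>(y, 0)\<close> with \<open>y \<in> B\<close>, tagged \<open>True\<close>, and the pairs in \<open>D\<close>, tagged \<open>False\<close>.\<close>

locale leibniz_pair = tracial_vn_subalgebra M \<tau> A
  for M :: "'h::complex_hilbert bop set" and \<tau> A +
  fixes B :: "'h bop set" and D :: "('h bop \<times> 'h bop) set"
  assumes B_alg: "unital_subalgebra B" and B_sub: "B \<subseteq> M"
    and D_fst: "e \<in> D \<Longrightarrow> fst e \<in> A"
    and D_snd: "e \<in> D \<Longrightarrow> snd e \<in> M" "e \<in> D \<Longrightarrow> snd e \<in> commutant (commutant A)"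
    and D_tr: "e \<in> D \<Longrightarrow> \<tau> (snd e) = 0"
    and D_one: "(1, 0) \<in> D"
    and D_dmul: "e \<in> D \<Longrightarrow> f \<in> D \<Longrightarrow> dmul e f \<in> D"
    and D_diff: "e \<in> D \<Longrightarrow> (fst e - c *\<^sub>C 1, snd e) \<in> D"
begin

definition letters :: "bool \<Rightarrow> ('h bop \<times> 'h bop) set" where
  "letters b = (if b then {e. fst e \<in> B \<and> snd e = 0} else D)"

definition tagged :: "(bool \<times> 'h bop \<times> 'h bop) list \<Rightarrow> bool" where
  "tagged es \<longleftrightarrow> (\<forall>x\<in>set es. snd x \<in> letters (fst x))"

lemma tagged_simps [simp]:
  "tagged []" "tagged (x # es) \<longleftrightarrow> snd x \<in> letters (fst x) \<and> tagged es"
  "tagged (us @ vs) \<longleftrightarrow> tagged us \<and> tagged vs"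
  by (auto simp: tagged_def)

lemma letters_fst: "e \<in> letters b \<Longrightarrow> fst e \<in> (if b then B else A)"
  by (auto simp: letters_def D_fst split: if_splits)

lemma letters_M: "e \<in> letters b \<Longrightarrow> fst e \<in> M \<and> snd e \<in> M"
  using B_sub D_fst D_snd(1) by (auto simp: letters_def split: if_splits)

lemma letters_dmul: "e \<in> letters b \<Longrightarrow> f \<in> letters b \<Longrightarrow> dmul e f \<in> letters b"
  using D_dmul unital_subalgebraD(3)[OF B_alg] by (auto simp: letters_def dmul_def split: if_splits)

lemma letters_tr: "e \<in> letters b \<Longrightarrow> \<tau> (snd e) = 0"
  by (auto simp: letters_def D_tr split: if_splits)

definition center :: "'h bop \<times> 'h bop \<Rightarrow> 'h bop \<times> 'h bop" where
  "center e = (fst e - \<tau> (fst e) *\<^sub>C 1, snd e)"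

lemma letters_center: "e \<in> letters b \<Longrightarrow> center e \<in> letters b"
  using D_diff unital_subalgebraD(1,4,7)[OF B_alg]
  by (auto simp: letters_def center_def split: if_splits)

lemma tr_center: "e \<in> letters b \<Longrightarrow> \<tau> (fst (center e)) = 0"
  using letters_M[of e b] by (simp add: center_def tr_diff tr_scale)

lemma tagged_M:
  assumes "tagged es"
  shows "prod_list (map (fst \<circ> snd) es) \<in> M" "leibniz (map snd es) \<in> M"
proof -
  have *: "fst (snd x) \<in> M \<and> snd (snd x) \<in> M" if "x \<in> set es" for x
  proof -
    have "snd x \<in> letters (fst x)" using assms that by (simp add: tagged_def)
    then show ?thesis by (rule letters_M)
  qed
  note alg = vn_unital_subalgebra[OF vN]
  show "prod_list (map (fst \<circ> snd) es) \<in> M"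
    by (rule prod_list_in_unital_subalgebra[OF alg]) (use * in auto)
  show "leibniz (map snd es) \<in> M"
    by (rule leibniz_in_unital_subalgebra[OF alg]) (use * in auto)
qed

lemma tr_leibniz_rotate:
  assumes "tagged us" "tagged vs"
  shows "\<tau> (leibniz (map snd (us @ vs))) = \<tau> (leibniz (map snd (vs @ us)))"
  using tagged_M[OF assms(1)] tagged_M[OF assms(2)]
  by (simp add: leibniz_append tr_add tr_commute[of "leibniz (map snd us)"]
      tr_commute[of "prod_list (map (fst \<circ> snd) us)" "leibniz (map snd vs)"])

text \<open>As (a, a') = (a - c 1, a') + (c 1, 0), centering changes the derivative by c times that
  of the word with the letter deleted, a word assumed to contribute nothing.\<close>

lemma tr_leibniz_center:
  assumes "tagged us" "snd x \<in> letters (fst x)" "tagged vs"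
    and zero: "\<tau> (leibniz (map snd (us @ vs))) = 0"
  shows "\<tau> (leibniz (map snd (us @ [map_prod id center x] @ vs))) = \<tau> (leibniz (map snd (us @ [x] @ vs)))"
proof -
  let ?e = "snd x"
  let ?c = "\<tau> (fst ?e)"
  have x': "snd (map_prod id center x) \<in> letters (fst (map_prod id center x))"
    using letters_center[OF assms(2)] by simp
  have eq: "leibniz (map snd (us @ [x] @ vs)) =
      leibniz (map snd (us @ [map_prod id center x] @ vs)) + ?c *\<^sub>C leibniz (map snd (us @ vs))"
    using leibniz_add[of "map snd us" "fst ?e - ?c *\<^sub>C 1" "?c *\<^sub>C 1" "snd ?e" 0 "map snd vs"]
      leibniz_scalar[of "map snd us" ?c "map snd vs"]
    by (simp add: center_def)
  have "leibniz (map snd (us @ [map_prod id center x] @ vs)) \<in> M" "leibniz (map snd (us @ vs)) \<in> M"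
    by (rule tagged_M(2); use assms x' in simp)+
  then show ?thesis unfolding eq using zero by (simp add: tr_add tr_scale)
qed

text \<open>The derivative of a single letter, cyclically moved to the front, multiplies an alternating product
  that starts and ends with the other tag; such a product is orthogonal to \<open>A\<close>.\<close>

lemma tr_leibniz_centered:
  assumes free: "free_family \<tau> (\<lambda>b. if b then B else A)"
    and cs: "tagged cs" "\<And>x. x \<in> set cs \<Longrightarrow> \<tau> (fst (snd x)) = 0"
    and alt: "distinct_adj (map fst cs)" "cs \<noteq> []" "fst (hd cs) \<noteq> fst (last cs)"
  shows "\<tau> (leibniz (map snd cs)) = 0"
proof -
  have prod0: "\<tau> (prod_list (map (fst \<circ> snd) xs)) = 0"
    if "xs \<noteq> []" "distinct_adj (map fst xs)" "tagged xs" "\<And>x. x \<in> set xs \<Longrightarrow> \<tau> (fst (snd x)) = 0" for xs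
  proof -
    let ?xs = "map (map_prod id fst) xs"
    have "map fst ?xs = map fst xs" "map snd ?xs = map (fst \<circ> snd) xs" by auto
    moreover have "\<forall>(b, T)\<in>set ?xs. T \<in> (if b then B else A) \<and> \<tau> T = 0"
      using that(3,4) letters_fst by (fastforce simp: tagged_def)
    ultimately show ?thesis using free that(1,2) unfolding free_family_def
      by (metis (no_types, lifting) map_is_Nil_conv)
  qed
  \<comment> \<open>\<open>us\<close> is the part already passed, whose letters stay underived; the
    induction treats the Leibniz terms one letter of \<open>vs\<close> at a time.\<close>
  have "\<tau> (prod_list (map (fst \<circ> snd) us) * leibniz (map snd vs)) = 0" if "cs = us @ vs" for us vs
    using that
  proof (induction vs arbitrary: us)
    case (Cons x vs)
    let ?P = "\<lambda>us. prod_list (map (fst \<circ> snd) us)"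
    have t: "tagged us" "tagged vs" "snd x \<in> letters (fst x)" using cs(1) Cons.prems by auto
    have M: "?P us \<in> M" "?P vs \<in> M" "leibniz (map snd vs) \<in> M" "fst (snd x) \<in> M" "snd (snd x) \<in> M"
      using tagged_M t letters_M by auto
    have IH: "\<tau> (?P (us @ [x]) * leibniz (map snd vs)) = 0" by (rule Cons.IH) (simp add: Cons.prems)
    have "\<tau> (snd (snd x) * ?P (vs @ us)) = 0"
    proof (cases "fst x")
      case True
      then have "snd (snd x) = 0" using t(3) by (simp add: letters_def)
      then show ?thesis by simp
    next
      case False
      then have xD: "snd x \<in> D" using t(3) by (simp add: letters_def)
      have ne: "vs @ us \<noteq> []" using alt(3) Cons.prems by auto
      have adj: "distinct_adj (map fst (vs @ us))" and hd: "fst (hd (vs @ us)) \<noteq> fst x"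
      proof -
        have d: "distinct_adj (map fst us @ fst x # map fst vs)" using alt(1) Cons.prems by simp
        have "us \<noteq> [] \<Longrightarrow> vs \<noteq> [] \<Longrightarrow> last (map fst vs) \<noteq> hd (map fst us)"
          using alt(3) Cons.prems by (simp add: last_map hd_map)
        with d show "distinct_adj (map fst (vs @ us))"
          by (auto simp: distinct_adj_append_iff distinct_adj_Cons)
        \<comment> \<open>If x is the last letter, its cyclic successor is the first one, and the
          condition on the two end tags of \<open>cs\<close> is used.\<close>
        show "fst (hd (vs @ us)) \<noteq> fst x"
        proof (cases vs)
          case Nil
          then show ?thesis using alt(3) ne Cons.prems by (cases us) auto
        next
          case (Cons v vs')
          then show ?thesis using d by (auto simp: distinct_adj_append_iff)
        qed
      qed
      have c0: "\<tau> (fst (snd y)) = 0" if "y \<in> set (vs @ us)" for y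
        by (rule cs(2)) (use that Cons.prems in auto)
      have d0: "\<tau> (?P (vs @ us)) = 0" by (rule prod0[OF ne adj]) (use t c0 in auto)
      have PM: "?P (vs @ us) \<in> M" using M by simp
      show ?thesis
      proof (rule trace_orthogonal_bicommutant[OF D_snd[OF xD] PM])
        fix a assume a: "a \<in> A"
        \<comment> \<open>The centered part can open a longer alternating product; the scalar part
          only multiplies a trace already known to be 0.\<close>
        define a0 where "a0 = a - \<tau> a *\<^sub>C 1"
        have a0: "a0 \<in> A" "\<tau> a0 = 0"
          using a A_closed by (auto simp: a0_def tr_diff tr_scale)
        let ?ys = "(False, a0) # map (map_prod id fst) (vs @ us)"
        have "map fst ?ys = False # map fst (vs @ us)" by simp
        moreover have "distinct_adj (False # map fst (vs @ us))"
          using adj hd ne False by (cases "vs @ us") auto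
        moreover have "\<forall>(b, T)\<in>set ?ys. T \<in> (if b then B else A) \<and> \<tau> T = 0"
          using t(1,2) letters_fst c0 a0 by (fastforce simp: tagged_def)
        ultimately have "\<tau> (prod_list (map snd ?ys)) = 0"
          using free unfolding free_family_def by (metis (no_types, lifting) list.distinct(1))
        moreover have "map snd (map (map_prod id fst) zs) = map (fst \<circ> snd) zs"
          for zs :: "(bool \<times> 'h bop \<times> 'h bop) list" by auto
        ultimately have "\<tau> (a0 * ?P (vs @ us)) = 0" by (simp del: map_map)
        moreover have "a * ?P (vs @ us) = a0 * ?P (vs @ us) + \<tau> a *\<^sub>C ?P (vs @ us)"
          by (simp add: a0_def left_diff_distrib scaleC_mult_left)
        ultimately show "\<tau> (a * ?P (vs @ us)) = 0"
          using d0 a0 PM by (simp add: tr_add tr_scale del: map_append)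
      qed
    qed
    then have "\<tau> (?P us * (snd (snd x) * ?P vs)) = 0"
      using tr_commute[of "?P us" "snd (snd x) * ?P vs"] M by (simp add: mult.assoc)
    then show ?case using IH M by (simp add: distrib_left tr_add mult.assoc comp_def)
  qed simp
  from this[of "[]" cs] show ?thesis by simp
qed

text \<open>Induction on the length works because merging neighbours of equal tag, also across the
  cyclic end, and deleting a letter while centering all shorten the word.\<close>

lemma tr_leibniz_free:
  assumes free: "free_family \<tau> (\<lambda>b. if b then B else A)" and es: "tagged es"
  shows "\<tau> (leibniz (map snd es)) = 0"
  using es
proof (induction "length es" arbitrary: es rule: less_induct)
  case less
  consider "es = []" | x where "es = [x]" | "length es \<ge> 2" "\<not> distinct_adj (map fst es)"
    | "length es \<ge> 2" "fst (hd es) = fst (last es)"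
    | "length es \<ge> 2" "distinct_adj (map fst es)" "fst (hd es) \<noteq> fst (last es)"
  proof (cases "length es \<ge> 2")
    case True
    then show thesis using that(3-5) by blast
  next
    case False
    then have "length es = 0 \<or> length es = 1" by linarith
    then have "es = [] \<or> (\<exists>x. es = [x])" by (auto simp: length_Suc_conv)
    then show thesis using that(1,2) by blast
  qed
  then show ?case
  proof cases
    case 1
    then show ?thesis by simp
  next
    \<comment> \<open>For a word of one letter the claim is that its derivative has trace 0: an
      assumption on D for one tag, trivial for the other.\<close>
    case 2
    then show ?thesis using less.prems letters_tr by simp
  next
    case 3
    obtain us p q vs where s: "es = us @ [p, q] @ vs" "fst p = fst q"
      using not_distinct_adj_map_split[OF 3(2)] by blast
    let ?es = "us @ [(fst p, dmul (snd p) (snd q))] @ vs"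
    have "tagged ?es" using less.prems s letters_dmul by auto
    then have "\<tau> (leibniz (map snd ?es)) = 0" by (intro less.hyps) (simp_all add: s)
    then show ?thesis using leibniz_dmul[of "map snd us" "snd p" "snd q" "map snd vs"] by (simp add: s)
  next
    case 4
    obtain p us q where s: "es = p # us @ [q]"
      using 4(1) by (cases es; cases "tl es" rule: rev_cases) auto
    \<comment> \<open>The last letter moves cyclically in front of the first, hence the order q,
      p.\<close>
    let ?es = "(fst p, dmul (snd q) (snd p)) # us"
    have pq: "fst p = fst q" using 4(2) s by simp
    have "tagged ?es" using less.prems s letters_dmul pq by auto
    then have "\<tau> (leibniz (map snd ?es)) = 0" by (intro less.hyps) (simp_all add: s)
    then have "\<tau> (leibniz (map snd ([q] @ p # us))) = 0"
      using leibniz_dmul[of "[]" "snd q" "snd p" "map snd us"] by simp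
    then show ?thesis using tr_leibniz_rotate[of "p # us" "[q]"] less.prems s by simp
  next
    case 5
    let ?c = "map_prod id center"
    have c_tag: "tagged (map ?c xs)" if "tagged xs" for xs
      using that letters_center by (auto simp: tagged_def)
    \<comment> \<open>Letters are centered from left to right; each correction term is a word one
      letter shorter, with centered prefix, to which the outer induction applies.\<close>
    have step: "\<tau> (leibniz (map snd (map ?c us @ vs))) = \<tau> (leibniz (map snd es))" if "es = us @ vs" for us vs
      using that
    proof (induction us arbitrary: vs rule: rev_induct)
      case (snoc x us)
      have t: "tagged us" "tagged vs" "snd x \<in> letters (fst x)" using less.prems snoc.prems by auto
      have "\<tau> (leibniz (map snd (map ?c us @ vs))) = 0"
        using t c_tag[OF t(1)] by (intro less.hyps) (simp_all add: snoc.prems)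
      from tr_leibniz_center[OF c_tag[OF t(1)] t(3) t(2) this] snoc.IH[of "x # vs"] snoc.prems
      show ?case by simp
    qed simp
    have "\<tau> (leibniz (map snd (map ?c es))) = 0"
    proof (rule tr_leibniz_centered[OF free c_tag[OF less.prems]])
      show "\<tau> (fst (snd x)) = 0" if "x \<in> set (map ?c es)" for x
        using that less.prems tr_center by (auto simp: tagged_def)
      have m: "map fst (map ?c es) = map fst es" by simp
      show "distinct_adj (map fst (map ?c es))" unfolding m by (rule 5(2))
      show ne: "map ?c es \<noteq> []" using 5(1) by auto
      show "fst (hd (map ?c es)) \<noteq> fst (last (map ?c es))"
        using 5(3) ne by (simp add: hd_map last_map)
    qed
    then show ?thesis using step[of es "[]"] by simp
  qed
qed

text \<open>Elements of B lie in the commutant of A, so they also commute with the derivatives,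
  which lie in the bicommutant. All of them collect on the left, and the whole derivative becomes y
  z' with a single pair (z, z') in D.\<close>

lemma tr_leibniz_independent:
  assumes comm: "\<And>y a. y \<in> B \<Longrightarrow> a \<in> A \<Longrightarrow> y * a = a * y"
    and ind: "\<And>y a. y \<in> B \<Longrightarrow> a \<in> A \<Longrightarrow> \<tau> (y * a) = \<tau> y * \<tau> a" and es: "tagged es"
  shows "\<tau> (leibniz (map snd es)) = 0"
proof -
  have comm': "y * e' = e' * y" if "y \<in> B" "(e, e') \<in> D" for y e e'
  proof -
    have "y \<in> commutant A" using comm[OF that(1)] by (auto simp: commutant_def)
    moreover have "e' \<in> commutant (commutant A)" using D_snd(2)[OF that(2)] by simp
    ultimately show ?thesis by (auto simp: commutant_def)
  qed
  have "\<exists>y\<in>B. \<exists>z z'. (z, z') \<in> D \<and> prod_list (map (fst \<circ> snd) es) = y * z \<and> leibniz (map snd es) = y * z'"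
    using es
  proof (induction es)
    case Nil
    show ?case using D_one unital_subalgebraD(1)[OF B_alg]
      by (intro bexI[of _ 1] exI[of _ 1] exI[of _ 0]) auto
  next
    case (Cons x es)
    then have "tagged es" by simp
    from Cons.IH[OF this] obtain y z z' where y: "y \<in> B" "(z, z') \<in> D"
      "prod_list (map (fst \<circ> snd) es) = y * z" "leibniz (map snd es) = y * z'" by blast
    obtain b a a' where x: "x = (b, a, a')" by (cases x)
    show ?case
    proof (cases b)
      case True
      then have "a \<in> B" "a' = 0" using Cons.prems x by (auto simp: letters_def)
      then have "a * y \<in> B" "prod_list (map (fst \<circ> snd) (x # es)) = a * y * z"
        "leibniz (map snd (x # es)) = a * y * z'"
        using y x unital_subalgebraD(3)[OF B_alg, of a y] by (simp_all add: mult.assoc comp_def)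
      then show ?thesis using y(2) by blast
    next
      case False
      then have a: "(a, a') \<in> D" using Cons.prems x by (auto simp: letters_def)
      have ca: "a * y = y * a" "a' * y = y * a'"
        using comm[OF y(1)] D_fst[OF a] comm'[OF y(1) a] by auto
      have "(a * z, a' * z + a * z') \<in> D" using D_dmul[OF a y(2)] by (simp add: dmul_def)
      moreover have "a * (y * z) = y * (a * z)" "a' * (y * z) = y * (a' * z)" "a * (y * z') = y * (a * z')"
        using ca by (simp_all add: mult.assoc[symmetric])
      ultimately have "(a * z, a' * z + a * z') \<in> D"
        "prod_list (map (fst \<circ> snd) (x # es)) = y * (a * z)"
        "leibniz (map snd (x # es)) = y * (a' * z + a * z')"
        using y x by (simp_all add: distrib_left comp_def)
      then show ?thesis using y(1) by blast
    qed
  qed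
  then obtain y z z' where y: "y \<in> B" "(z, z') \<in> D" "leibniz (map snd es) = y * z'" by blast
  have yM: "y \<in> M" using y(1) B_sub by blast
  have z': "z' \<in> M" "z' \<in> commutant (commutant A)" "\<tau> z' = 0"
    using D_snd[OF y(2)] D_tr[OF y(2)] by auto
  \<comment> \<open>Independence says that y - \<tau>(y) 1 is trace orthogonal to A; this extends to
    the bicommutant, where z' lives.\<close>
  have "\<tau> (z' * (y - \<tau> y *\<^sub>C 1)) = 0"
  proof (rule trace_orthogonal_bicommutant[OF z'(1,2)])
    show "y - \<tau> y *\<^sub>C 1 \<in> M" using yM by simp
    fix a assume a: "a \<in> A"
    have "\<tau> (a * y) = \<tau> y * \<tau> a" using ind[OF y(1) a] comm[OF y(1) a] by simp
    then show "\<tau> (a * (y - \<tau> y *\<^sub>C 1)) = 0"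
      using a yM by (simp add: right_diff_distrib scaleC_mult_right tr_diff tr_scale)
  qed
  then have "\<tau> (z' * y) = 0"
    using yM z' by (simp add: right_diff_distrib scaleC_mult_right tr_diff tr_scale)
  then show ?thesis using tr_commute[OF yM z'(1)] y(3) by simp
qed

end

section \<open>Cyclic derivatives\<close>

lemma nc_eval_superset:
  assumes "finite K" "Poly_Mapping.keys P \<subseteq> K"
  shows "nc_eval P X = (\<Sum>w\<in>K. Poly_Mapping.lookup P w *\<^sub>C prod_list (map X w))"
  unfolding nc_eval_def using assms
  by (intro sum.mono_neutral_left) (auto simp: in_keys_iff)

lemma nc_eval_0 [simp]: "nc_eval 0 X = 0"
  by (simp add: nc_eval_def)

lemma nc_eval_add: "nc_eval (P + Q) X = nc_eval P X + nc_eval Q X"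
proof -
  let ?K = "Poly_Mapping.keys P \<union> Poly_Mapping.keys Q"
  have "nc_eval R X = (\<Sum>w\<in>?K. Poly_Mapping.lookup R w *\<^sub>C prod_list (map X w))"
    if "R \<in> {P, Q, P + Q}" for R
    using that Poly_Mapping.keys_add[of P Q] by (intro nc_eval_superset) auto
  then show ?thesis by (simp add: lookup_add scaleC_add_left sum.distrib)
qed

lemma nc_eval_sum: "nc_eval (sum f I) X = (\<Sum>i\<in>I. nc_eval (f i) X)"
  by (induction I rule: infinite_finite_induct) (simp_all add: nc_eval_add)

lemma nc_eval_single: "nc_eval (Poly_Mapping.single w c) X = c *\<^sub>C prod_list (map X w)"
  by (cases "c = 0") (simp_all add: nc_eval_def)

lemma nc_eval_in_unital_subalgebra:
  assumes A: "unital_subalgebra A" and X: "\<And>j. X j \<in> A"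
  shows "nc_eval P X \<in> A"
  unfolding nc_eval_def
  by (intro sum_in_unital_subalgebra[OF A] unital_subalgebraD(4)[OF A]
      prod_list_in_unital_subalgebra[OF A]) (use X in auto)

text \<open>At each occurrence of j, the cyclic derivative puts what follows before what precedes;
  traciality returns the preceding part to the front and leaves \<open>x j\<close> at the deleted
  position.\<close>

lemma (in tracial_vn) tr_cyc_deriv_single:
  fixes X x :: "'n::finite \<Rightarrow> 'h bop"
  assumes X: "\<And>j. X j \<in> M" and x: "\<And>j. x j \<in> M"
  shows "\<tau> (\<Sum>j\<in>UNIV. x j * nc_eval (cyc_deriv j (Poly_Mapping.single w c)) X)
    = c * \<tau> (leibniz (map (\<lambda>j. (X j, x j)) w))"
proof -
  let ?p = "\<lambda>k. prod_list (map X (drop (Suc k) w @ take k w))"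
  have PM: "prod_list (map X u) \<in> M" for u
    by (rule prod_list_in_unital_subalgebra[OF vn_unital_subalgebra[OF vN]]) (use X in auto)
  have "(\<Sum>j\<in>UNIV. x j * nc_eval (cyc_deriv j (Poly_Mapping.single w c)) X)
      = (\<Sum>j\<in>UNIV. \<Sum>k | k < length w \<and> w ! k = j. x (w ! k) * (c *\<^sub>C ?p k))"
    by (simp add: cyc_deriv_single nc_eval_sum nc_eval_single sum_distrib_left)
  also have "\<dots> = (\<Sum>j\<in>UNIV. \<Sum>k\<in>{k \<in> {..<length w}. w ! k = j}. x (w ! k) * (c *\<^sub>C ?p k))"
    by simp
  also have "\<dots> = (\<Sum>k<length w. x (w ! k) * (c *\<^sub>C ?p k))"
    by (rule sum.group) auto
  finally have "\<tau> (\<Sum>j\<in>UNIV. x j * nc_eval (cyc_deriv j (Poly_Mapping.single w c)) X)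
      = (\<Sum>k<length w. \<tau> (x (w ! k) * (c *\<^sub>C ?p k)))"
    using tr_sum[of "{..<length w}" "\<lambda>k. x (w ! k) * (c *\<^sub>C ?p k)"] x PM by simp
  also have "\<dots> = (\<Sum>k<length w. c * \<tau> (prod_list (map X (take k w)) * x (w ! k) * prod_list (map X (drop (Suc k) w))))"
  proof (rule sum.cong)
    fix k assume "k \<in> {..<length w}"
    have "\<tau> (x (w ! k) * ?p k) = \<tau> (prod_list (map X (take k w)) * (x (w ! k) * prod_list (map X (drop (Suc k) w))))"
      using tr_commute[of "prod_list (map X (take k w))" "x (w ! k) * prod_list (map X (drop (Suc k) w))"]
        PM x by (simp add: mult.assoc)
    then show "\<tau> (x (w ! k) * (c *\<^sub>C ?p k)) = c * \<tau> (prod_list (map X (take k w)) * x (w ! k) * prod_list (map X (drop (Suc k) w)))"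
      using PM[of "drop (Suc k) w @ take k w"] x by (simp add: scaleC_mult_right tr_scale mult.assoc)
  qed simp
  also have "\<dots> = c * \<tau> (leibniz (map (\<lambda>j. (X j, x j)) w))"
    unfolding leibniz_word sum_distrib_left[symmetric]
    using tr_sum[of "{..<length w}" "\<lambda>k. prod_list (map X (take k w)) * x (w ! k) * prod_list (map X (drop (Suc k) w))"]
      PM x by simp
  finally show ?thesis .
qed

lemma (in tracial_vn) tr_cyc_deriv_zero:
  fixes X x :: "'n::finite \<Rightarrow> 'h bop"
  assumes X: "\<And>j. X j \<in> M" and x: "\<And>j. x j \<in> M"
    and z: "\<And>w. \<tau> (leibniz (map (\<lambda>j. (X j, x j)) w)) = 0"
  shows "\<tau> (\<Sum>j\<in>UNIV. x j * nc_eval (cyc_deriv j P) X) = 0"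
proof -
  note alg = vn_unital_subalgebra[OF vN]
  have sM: "(\<Sum>j\<in>UNIV. x j * nc_eval (cyc_deriv j Q) X) \<in> M" for Q
    by (intro sum_in_unital_subalgebra[OF alg] M_closed(3) x nc_eval_in_unital_subalgebra[OF alg] X)
  show ?thesis
  proof (induction P rule: update_induct)
    case const
    show ?case by (simp add: cyc_deriv_def)
  next
    case (update f w c)
    have "Poly_Mapping.update w c f = f + Poly_Mapping.single w c"
      using update.hyps(1)
      by (intro poly_mapping_eqI) (auto simp: lookup_update lookup_add lookup_single in_keys_iff when_def)
    then show ?case
      using update.IH tr_cyc_deriv_single[OF X x, where w = w and c = c] z sM[of f] sM[of "Poly_Mapping.single w c"]
      by (simp add: cyc_deriv_add nc_eval_add distrib_left sum.distrib tr_add)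
  qed
qed

section \<open>Conditional expectations and the orthogonal of the cyclic gradients\<close>

text \<open>Only positivity of E is given, so T is shifted by a scalar bounding its norm: the sum is
  positive, and the scalar, lying in N, is fixed by E.\<close>

lemma conditional_expectation_adj:
  assumes E: "conditional_expectation M N E" and M: "von_neumann_algebra M" and N: "von_neumann_algebra N"
    and "T \<in> M" and T: "adj T = T"
  shows "adj (E T) = E T"
proof -
  note cM = unital_subalgebraD[OF vn_unital_subalgebra[OF M]]
    and cN = unital_subalgebraD[OF vn_unital_subalgebra[OF N]]
  obtain K where K: "K > 0" "\<And>x. norm (app T x) \<le> K * norm x" using app_bound by blast
  let ?k = "complex_of_real K *\<^sub>C (1 :: 'a bop)"
  have kM: "?k \<in> M" "?k \<in> N" by (rule cM(4)[OF cM(1)], rule cN(4)[OF cN(1)])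
  have adjk: "adj ?k = ?k" by simp
  have "positive_op (T + ?k)"
  proof (rule positive_opI)
    show "adj (T + ?k) = T + ?k" by (simp add: T)
    fix x
    have "\<bar>inner (app T x) x\<bar> \<le> norm (app T x) * norm x" by (rule Cauchy_Schwarz_ineq2)
    also have "\<dots> \<le> K * norm x * norm x" by (intro mult_right_mono K) simp
    finally show "0 \<le> inner (app (T + ?k) x) x"
      by (simp add: inner_add_left scaleC_of_real power2_norm_eq_inner[symmetric] power2_eq_square)
  qed
  moreover have "T + ?k \<in> M" by (rule cM(2)[OF \<open>T \<in> M\<close> kM(1)])
  ultimately have "positive_op (E (T + ?k))" using E by (auto simp: conditional_expectation_def)
  moreover have "E (T + ?k) = E T + ?k"
    using E kM \<open>T \<in> M\<close> by (auto simp: conditional_expectation_def)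
  ultimately have "adj (E T + ?k) = E T + ?k" using positive_op_adj by metis
  then show ?thesis by simp
qed

theorem proposition5p14:
  fixes M :: "'h::complex_hilbert bop set"
    and \<tau> :: "'h bop \<Rightarrow> complex"
    and Y Z \<xi> :: "'n::finite \<Rightarrow> 'h bop"
  assumes "von_neumann_algebra M"
    and "trace_state M \<tau>" and "faithful_on M \<tau>" and "normal_on M \<tau>"
    and "\<forall>j. Y j \<in> hermitian_part M"
    and "\<forall>j. Z j \<in> hermitian_part M"
    and "independent_in \<tau> (range Y) (range Z) \<or> freely_independent_in \<tau> (range Y) (range Z)"
    and "\<forall>j. \<xi> j \<in> hermitian_part (vn_generated (range Z))"
    and "\<forall>P. \<tau> (\<Sum>j\<in>UNIV. \<xi> j * nc_eval (cyc_deriv j P) Z) = 0"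
  shows "(\<forall>P. \<tau> (\<Sum>j\<in>UNIV. \<xi> j * nc_eval (cyc_deriv j P) (\<lambda>j. Y j + Z j)) = 0)
    \<and> (\<forall>E. conditional_expectation M (vn_generated (range (\<lambda>j. Y j + Z j))) E
            \<and> trace_preserving M \<tau> E
          \<longrightarrow> (\<lambda>j. E (\<xi> j)) \<in> cyc_grad_orthogonal \<tau> (\<lambda>j. Y j + Z j))"
proof -
  interpret tracial_vn M \<tau> using assms by unfold_locales
  let ?A = "alg_generated (range Z)" and ?B = "alg_generated (range Y)"
  let ?X = "\<lambda>j. Y j + Z j"
  define h where "h j = (Z j, \<xi> j)" for j
  note algM = vn_unital_subalgebra[OF vN]
  have YM: "Y j \<in> M" and ZM: "Z j \<in> M" and Zadj: "adj (Z j) = Z j" for j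
    using assms(5,6) by (auto simp: hermitian_part_def)
  have \<xi>W: "\<xi> j \<in> vn_generated (range Z)" and \<xi>adj: "adj (\<xi> j) = \<xi> j" for j
    using assms(8) by (auto simp: hermitian_part_def)
  have \<xi>M: "\<xi> j \<in> M" for j using vn_generated_subset[of "range Z" M] vN ZM \<xi>W by blast
  have \<xi>A: "\<xi> j \<in> commutant (commutant ?A)" for j
    using vn_generated_bicommutant[of "range Z"] Zadj \<xi>W by blast
  have AM: "?A \<subseteq> M" by (rule alg_generated_subset[OF _ algM]) (use ZM in auto)
  have BM: "?B \<subseteq> M" by (rule alg_generated_subset[OF _ algM]) (use YM in auto)
  interpret tracial_vn_subalgebra M \<tau> ?A
    using AM Zadj by unfold_locales (auto intro: unital_subalgebra_alg_generated adj_alg_generated)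
  have ZA: "Z j \<in> ?A" and YB: "Y j \<in> ?B" for j
    using subset_alg_generated[of "range Z"] subset_alg_generated[of "range Y"] by auto
  \<comment> \<open>The hypothesis on \<xi>, taken for the monomial w with coefficient 1.\<close>
  have Z_zero: "\<tau> (leibniz (map h w)) = 0" for w
    using tr_cyc_deriv_single[of Z \<xi> w 1, OF ZM \<xi>M] assms(9)
    by (simp add: h_def[abs_def])
  have span_M: "a' \<in> M" if "(a, a') \<in> word_span h" for a a'
    using word_span_snd_in[OF algM _ _ that] ZM \<xi>M by (simp add: h_def)
  have span_cc: "a' \<in> commutant (commutant ?A)" if "(a, a') \<in> word_span h" for a a'
    using word_span_snd_in[OF unital_subalgebra_commutant _ _ that] subset_bicommutant[of ?A] ZA \<xi>A
    by (auto simp: h_def)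
  have span_tr: "\<tau> a' = 0" if "(a, a') \<in> word_span h" for a a'
    using that
    by induction (auto simp: Z_zero tr_add tr_scale span_M)
  interpret leibniz_pair M \<tau> ?A ?B "word_span h"
  proof unfold_locales
    fix e f c assume e: "e \<in> word_span h"
    then show "fst e \<in> ?A"
      using word_span_fst_in[OF A_alg, of h "fst e" "snd e"] ZA by (simp add: h_def)
    show "snd e \<in> M" "snd e \<in> commutant (commutant ?A)" "\<tau> (snd e) = 0"
      using span_M span_cc span_tr e by (metis prod.collapse)+
    show "f \<in> word_span h \<Longrightarrow> dmul e f \<in> word_span h" by (rule word_span_dmul[OF e])
    show "(fst e - c *\<^sub>C 1, snd e) \<in> word_span h" using word_span_diff_scalar e by (metis prod.collapse)
  qed (use BM unital_subalgebra_alg_generated word_span_one in auto)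
  have tagged_zero: "\<tau> (leibniz (map snd es)) = 0" if "tagged es" for es
    using assms(7)
  proof
    assume ind: "independent_in \<tau> (range Y) (range Z)"
    show ?thesis
      by (rule tr_leibniz_independent[OF _ _ that]) (use ind in \<open>auto simp: independent_in_def\<close>)
  next
    assume "freely_independent_in \<tau> (range Y) (range Z)"
    then show ?thesis unfolding freely_independent_in_def by (rule tr_leibniz_free[OF _ that])
  qed
  \<comment> \<open>\<open>es\<close> holds the letters already split into a Y or a Z part, and w
    those still to be split; \<open>es\<close> must be arbitrary since each split extends
    it.\<close>
  have "\<tau> (leibniz (map snd es @ map (\<lambda>j. (?X j, \<xi> j)) w)) = 0" if "tagged es" for es w
    using that
  proof (induction w arbitrary: es)
    case Nil
    then show ?case using tagged_zero by simp
  next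
    case (Cons j w)
    let ?w = "map (\<lambda>j. (?X j, \<xi> j)) w"
    have ty: "tagged (es @ [(True, (Y j, 0))])" using Cons.prems YB by (simp add: letters_def)
    have tz: "tagged (es @ [(False, (Z j, \<xi> j))])"
      using Cons.prems word_span_generator[of h j] by (simp add: letters_def h_def[of j])
    have t: "\<tau> (leibniz (map snd es @ [(Y j, 0)] @ ?w)) = 0" "\<tau> (leibniz (map snd es @ [(Z j, \<xi> j)] @ ?w)) = 0"
      using Cons.IH[OF ty] Cons.IH[OF tz] by simp_all
    have wM: "leibniz (map snd es @ [e] @ ?w) \<in> M" if "fst e \<in> M" "snd e \<in> M" for e
    proof (rule leibniz_in_unital_subalgebra[OF algM])
      have "fst (snd x) \<in> M \<and> snd (snd x) \<in> M" if "x \<in> set es" for x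
      proof -
        have "snd x \<in> letters (fst x)" using Cons.prems that by (simp add: tagged_def)
        then show ?thesis by (rule letters_M)
      qed
      then show "fst ` set (map snd es @ [e] @ ?w) \<subseteq> M" "snd ` set (map snd es @ [e] @ ?w) \<subseteq> M"
        using that YM ZM \<xi>M by auto
    qed
    have "leibniz (map snd es @ map (\<lambda>j. (?X j, \<xi> j)) (j # w))
        = leibniz (map snd es @ [(Y j, 0)] @ ?w) + leibniz (map snd es @ [(Z j, \<xi> j)] @ ?w)"
      using leibniz_add[of "map snd es" "Y j" "Z j" 0 "\<xi> j" ?w] by simp
    then show ?case
      using t wM[of "(Y j, 0)"] wM[of "(Z j, \<xi> j)"] YM ZM \<xi>M by (simp add: tr_add del: append_Cons)
  qed
  from this[of "[]"] have X_zero: "\<tau> (leibniz (map (\<lambda>j. (?X j, \<xi> j)) w)) = 0" for w by simp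
  have XM: "?X j \<in> M" for j using YM ZM by simp
  have main: "\<tau> (\<Sum>j\<in>UNIV. \<xi> j * nc_eval (cyc_deriv j P) ?X) = 0" for P
    by (rule tr_cyc_deriv_zero[OF XM \<xi>M X_zero])
  let ?N = "vn_generated (range ?X)"
  have "(\<lambda>j. E (\<xi> j)) \<in> cyc_grad_orthogonal \<tau> ?X"
    if E: "conditional_expectation M ?N E" and tp: "trace_preserving M \<tau> E" for E
    unfolding cyc_grad_orthogonal_def
  proof (safe)
    note vnN = von_neumann_algebra_vn_generated[of "range ?X"]
    note algN = vn_unital_subalgebra[OF vnN]
    show "E (\<xi> j) \<in> hermitian_part ?N" for j
      using conditional_expectation_adj[OF E vN vnN \<xi>M \<xi>adj] E \<xi>M
      by (auto simp: hermitian_part_def conditional_expectation_def)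
    fix P
    let ?p = "\<lambda>j. nc_eval (cyc_deriv j P) ?X"
    have pN: "?p j \<in> ?N" for j
      by (rule nc_eval_in_unital_subalgebra[OF algN]) (use subset_vn_generated[of "range ?X"] in auto)
    have pM: "?p j \<in> M" for j by (rule nc_eval_in_unital_subalgebra[OF algM XM])
    have "\<tau> (E (\<xi> j) * ?p j) = \<tau> (\<xi> j * ?p j)" for j
    proof -
      \<comment> \<open>The bimodule rule takes a factor from the subalgebra on either side; the
        left one is set to 1.\<close>
      have "E (1 * \<xi> j * ?p j) = 1 * E (\<xi> j) * ?p j"
        using E \<xi>M pN unital_subalgebraD(1)[OF algN] unfolding conditional_expectation_def by blast
      then have "\<tau> (E (\<xi> j) * ?p j) = \<tau> (E (\<xi> j * ?p j))" by simp
      also have "\<dots> = \<tau> (\<xi> j * ?p j)" using tp \<xi>M pM by (simp add: trace_preserving_def)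
      finally show ?thesis .
    qed
    then have "(\<Sum>j\<in>UNIV. \<tau> (E (\<xi> j) * ?p j)) = \<tau> (\<Sum>j\<in>UNIV. \<xi> j * ?p j)"
      using tr_sum[of UNIV "\<lambda>j. \<xi> j * ?p j"] \<xi>M pM by simp
    then show "(\<Sum>j\<in>UNIV. \<tau> (E (\<xi> j) * ?p j)) = 0" using main by simp
  qed
  with main show ?thesis by blast
qed

end
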